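(* Let $k$ be a positive integer and let $\mathcal{S}_+^{k+1}$ be the cone of $(k+1)\times(k+1)$ real symmetric positive semidefinite matrices. Let $p$ be a homogeneous polynomial with real coefficients that is hyperbolic with respect to $e$ and all of whose irreducible factors have degree at most $k$. Then $\mathcal{S}_+^{k+1}$ does not have a $\Lambda_+(p,e)$-lift.
   Context: Lift: if $C\subseteq\mathbb{R}^n$ and $K\subseteq\mathbb{R}^d$ are closed convex cones, $C$ has a $K$-lift if $C=\pi(K\cap L)$ for some linear map $\pi:\mathbb{R}^d\to\mathbb{R}^n$ and some linear subspace $L\subseteq\mathbb{R}^d$. Here the space of $(k+1)\times(k+1)$ real symmetric matrices is identified with $\mathbb{R}^{\binom{k+2}{2}}$. Hyperbolicity: a homogeneous polynomial $p$ in $q$ variables with real coefficients is hyperbolic with respect to $e\in\mathbb{R}^q$ if $p(e)>0$ and, for all $x\in\mathbb{R}^q$, the univariate polynomial $t\mapsto p(te-x)$ has only real roots; these roots are the hyperbolic eigenvalues of $x$. The hyperbolicity cone is $\Lambda_+(p,e)=\{x\in\mathbb{R}^q : \text{all hyperbolic eigenvalues of } x \text{ are nonnegative}\}$, which is a closed convex cone (a result of Gårding). Irreducible factors of $p$ are its factors in a factorization into irreducible real polynomials. *)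

theory Defs
  imports
    "HOL-Analysis.Analysis"
    "HOL-Library.Poly_Mapping"
    "HOL-Library.Multiset"
    "HOL-Computational_Algebra.Factorial_Ring"
    "HOL-Computational_Algebra.Polynomial"
begin

text \<open>
  Real polynomials in the variables indexed by \<open>'q\<close>: finitely supported maps from exponent
  vectors to coefficients, with the convolution product of \<^theory>\<open>HOL-Library.Poly_Mapping\<close>.
\<close>

type_synonym 'q real_mpoly = "('q \<Rightarrow>\<^sub>0 nat) \<Rightarrow>\<^sub>0 real"

definition monom_degree :: "('q::finite \<Rightarrow>\<^sub>0 nat) \<Rightarrow> nat" where
  "monom_degree m = (\<Sum>i\<in>UNIV. Poly_Mapping.lookup m i)"

text \<open>The zero polynomial gets degree 0.\<close>

definition total_degree :: "'q::finite real_mpoly \<Rightarrow> nat" where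
  "total_degree p = Max (insert 0 (monom_degree ` Poly_Mapping.keys p))"

definition homogeneous :: "'q::finite real_mpoly \<Rightarrow> bool" where
  "homogeneous p \<longleftrightarrow> (\<exists>d. \<forall>m\<in>Poly_Mapping.keys p. monom_degree m = d)"

text \<open>Substitution of \<open>x i\<close> for the \<open>i\<close>-th variable, with coefficients transported along \<open>h\<close>.\<close>

definition mpoly_subst :: "(real \<Rightarrow> 'a::comm_ring_1) \<Rightarrow> 'q::finite real_mpoly \<Rightarrow> ('q \<Rightarrow> 'a) \<Rightarrow> 'a" where
  "mpoly_subst h p x = (\<Sum>m\<in>Poly_Mapping.keys p. h (Poly_Mapping.lookup p m) * (\<Prod>i\<in>UNIV. x i ^ Poly_Mapping.lookup m i))"

definition mpoly_eval :: "'q::finite real_mpoly \<Rightarrow> real ^ 'q \<Rightarrow> real" where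
  "mpoly_eval p x = mpoly_subst (\<lambda>c. c) p (\<lambda>i. x $ i)"

definition irreducible_factor :: "'q::finite real_mpoly \<Rightarrow> 'q real_mpoly \<Rightarrow> bool" where
  "irreducible_factor f p \<longleftrightarrow>
     (\<exists>c F. c dvd 1 \<and> (\<forall>g\<in>#F. irreducible g) \<and> p = c * prod_mset F \<and> f \<in># F)"

text \<open>The univariate polynomial \<open>t \<mapsto> p (t e - x)\<close>.\<close>

definition line_poly :: "'q::finite real_mpoly \<Rightarrow> real ^ 'q \<Rightarrow> real ^ 'q \<Rightarrow> real poly" where
  "line_poly p e x = mpoly_subst (\<lambda>c. [:c:]) p (\<lambda>i. [:- (x $ i), e $ i:])"

lemma poly_line_poly: "poly (line_poly p e x) t = mpoly_eval p (t *\<^sub>R e - x)"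
  by (simp add: line_poly_def mpoly_eval_def mpoly_subst_def poly_sum poly_prod algebra_simps)

definition real_rooted :: "real poly \<Rightarrow> bool" where
  "real_rooted u \<longleftrightarrow> (\<forall>z::complex. poly (map_poly complex_of_real u) z = 0 \<longrightarrow> z \<in> \<real>)"

definition hyperbolic :: "'q::finite real_mpoly \<Rightarrow> real ^ 'q \<Rightarrow> bool" where
  "hyperbolic p e \<longleftrightarrow>
     mpoly_eval p e > 0 \<and> (\<forall>x. real_rooted (line_poly p e x))"

definition hyp_eigenvalues :: "'q::finite real_mpoly \<Rightarrow> real ^ 'q \<Rightarrow> real ^ 'q \<Rightarrow> real set" where
  "hyp_eigenvalues p e x = {t. poly (line_poly p e x) t = 0}"

definition hyperbolicity_cone :: "'q::finite real_mpoly \<Rightarrow> real ^ 'q \<Rightarrow> (real ^ 'q) set" where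
  "hyperbolicity_cone p e = {x. \<forall>t\<in>hyp_eigenvalues p e x. 0 \<le> t}"

definition sym_matrices :: "(real ^ 'm ^ 'm) set" where
  "sym_matrices = {A. transpose A = A}"

definition psd_cone :: "(real ^ 'm ^ 'm) set" where
  "psd_cone = {A \<in> sym_matrices. \<forall>v. 0 \<le> v \<bullet> (A *v v)}"

text \<open>
  \<open>has_lift V C K\<close>: the subset \<open>C\<close> of the vector space \<open>V\<close> has a \<open>K\<close>-lift.  The explicit ambient
  space \<open>V\<close> is there so that the target of the projection can be the space of symmetric
  matrices rather than the space of all square matrices.
\<close>

definition has_lift :: "'b::euclidean_space set \<Rightarrow> 'b set \<Rightarrow> 'a::euclidean_space set \<Rightarrow> bool" where
  "has_lift V C K \<longleftrightarrow>
     (\<exists>f L. linear f \<and> range f \<subseteq> V \<and> subspace L \<and> C = f ` (K \<inter> L))"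

end

theory Submission
  imports
    Defs
    "HOL-Computational_Algebra.Fundamental_Theorem_Algebra"
    "HOL-Library.Ramsey"
begin

text \<open>The invariant that separates the two cones is the length of chains of points, in the following sense.
In a convex cone \<open>K\<close> consider points \<open>y\<^sub>0, y\<^sub>1, \<dots>\<close> such that for every \<open>j\<close>
and every \<open>\<epsilon> > 0\<close> the point \<open>y\<^sub>0 + \<dots> + y\<^bsub>j-1\<^esub> - \<epsilon> y\<^sub>j\<close> lies outside \<open>K\<close>; in other words,
\<open>y\<^sub>j\<close> is not in the smallest face that contains its predecessors.  If \<open>K\<close> is the hyperbolicity cone
of a form \<open>p\<close> of degree \<open>d\<close>, such a sequence has at most \<open>d\<close> members: by \<open>order_drop\<close> each new
summand strictly lowers the multiplicity of the eigenvalue \<open>0\<close>, and this multiplicity is at most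
\<open>d\<close> at the start (\<open>chain_bound\<close>).

For the positive semidefinite cone take vectors \<open>v\<^sub>n\<close> on the moment curve.  For every set \<open>W\<close> of
\<open>k\<close> indices some vector \<open>u\<close> is orthogonal to exactly those \<open>v\<^sub>n\<close> with \<open>n \<in> W\<close>.
If \<open>y\<^sub>n\<close> lifts the matrix \<open>v\<^sub>n v\<^sub>n\<^sup>T\<close>, then the quadratic form at \<open>u\<close> of the projection of
\<open>(\<Sum>w\<in>W. y\<^sub>w) - \<epsilon> y\<^sub>n\<close> is \<open>- \<epsilon> (u \<bullet> v\<^sub>n)\<^sup>2 < 0\<close>, so that this point of the subspace is not
in the cone upstairs.

The cone upstairs is the intersection of the hyperbolicity cones of the irreducible factors
(\<open>hyperbolicity_cone_factors\<close>), each a form of degree at most \<open>k\<close>.  For every \<open>W\<close> and \<open>n\<close> a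
single factor is responsible for all \<open>\<epsilon>\<close> at once (\<open>persistent_exit\<close>).  Colouring the sets
\<open>W \<union> {n}\<close> with \<open>n\<close> above \<open>W\<close> by such a factor, Ramsey's theorem gives one factor that serves all of
them inside an infinite index set (\<open>uniform_chain_in_factor\<close>).  Its cone then contains a chain of
\<open>k + 1\<close> points, although its degree is at most \<open>k\<close>.

The facts about a hyperbolic form all come from one stability property (\<open>stable\<close>):
\<open>p\<close> does not vanish at \<open>t e + a x + b y\<close> when \<open>x\<close> and \<open>y\<close> lie in the cone, \<open>t\<close> is in the open
and \<open>a\<close>, \<open>b\<close> are in the closed upper half-plane.  It is proved by deforming a polynomial in
\<open>b\<close> whose roots can never cross the real axis (\<open>no_crossing\<close>).\<close>

section \<open>Substitution homomorphisms\<close>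

definition unital_hom :: "('a::comm_ring_1 \<Rightarrow> 'b::comm_ring_1) \<Rightarrow> bool" where
  "unital_hom h \<longleftrightarrow> (\<forall>a b. h (a + b) = h a + h b) \<and> (\<forall>a b. h (a * b) = h a * h b) \<and> h 1 = 1"

lemma unital_hom_add: "unital_hom h \<Longrightarrow> h (a + b) = h a + h b"
  and unital_hom_mult: "unital_hom h \<Longrightarrow> h (a * b) = h a * h b"
  and unital_hom_1: "unital_hom h \<Longrightarrow> h 1 = 1"
  by (auto simp: unital_hom_def)

lemma unital_hom_0: "unital_hom h \<Longrightarrow> h 0 = 0"
  using unital_hom_add[of h 0 0] by simp

lemma unital_hom_sum: "unital_hom h \<Longrightarrow> h (sum f A) = (\<Sum>a\<in>A. h (f a))"
  by (induction A rule: infinite_finite_induct) (auto simp: unital_hom_0 unital_hom_add)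

lemma unital_hom_prod: "unital_hom h \<Longrightarrow> h (prod f A) = (\<Prod>a\<in>A. h (f a))"
  by (induction A rule: infinite_finite_induct) (auto simp: unital_hom_1 unital_hom_mult)

lemma unital_hom_power: "unital_hom h \<Longrightarrow> h (a ^ n) = h a ^ n"
  by (induction n) (auto simp: unital_hom_1 unital_hom_mult)

lemma unital_hom_comp_subst:
  assumes "unital_hom \<phi>"
  shows "\<phi> (mpoly_subst h p x) = mpoly_subst (\<lambda>c. \<phi> (h c)) p (\<lambda>i. \<phi> (x i))"
  using assms by (simp add: mpoly_subst_def unital_hom_sum unital_hom_mult unital_hom_prod unital_hom_power)

lemma unital_hom_ident: "unital_hom (\<lambda>c. c)"
  and unital_hom_pCons: "unital_hom (\<lambda>c. [:c:])"
  and unital_hom_of_real: "unital_hom (of_real :: real \<Rightarrow> complex)"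
  and unital_hom_poly: "unital_hom (\<lambda>u. poly u z)"
  by (auto simp: unital_hom_def)

lemma unital_hom_comp: "unital_hom f \<Longrightarrow> unital_hom g \<Longrightarrow> unital_hom (\<lambda>x. f (g x))"
  by (simp add: unital_hom_def)

lemma unital_hom_complexify: "unital_hom (map_poly complex_of_real)"
  unfolding unital_hom_def
  by (auto simp: poly_eq_iff coeff_map_poly coeff_mult)

lemma mpoly_subst_superset:
  assumes "h 0 = 0" "finite S" "Poly_Mapping.keys p \<subseteq> S"
  shows "mpoly_subst h p x =
    (\<Sum>m\<in>S. h (Poly_Mapping.lookup p m) * (\<Prod>i\<in>UNIV. x i ^ Poly_Mapping.lookup m i))"
  unfolding mpoly_subst_def
  by (rule sum.mono_neutral_left) (use assms in \<open>auto simp: in_keys_iff\<close>)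

lemma mpoly_subst_add:
  assumes "unital_hom h"
  shows "mpoly_subst h (p + q) x = mpoly_subst h p x + mpoly_subst h q x"
proof -
  let ?S = "Poly_Mapping.keys p \<union> Poly_Mapping.keys q"
  have 0: "h 0 = 0" by (rule unital_hom_0[OF assms])
  show ?thesis
    using keys_add[of p q]
    by (subst (1 2 3) mpoly_subst_superset[where S = ?S])
      (auto simp: 0 lookup_add unital_hom_add[OF assms] distrib_right sum.distrib)
qed

lemma mpoly_subst_zero: "mpoly_subst h 0 x = 0"
  by (simp add: mpoly_subst_def)

lemma mpoly_subst_sum:
  assumes "unital_hom h"
  shows "mpoly_subst h (sum f A) x = (\<Sum>a\<in>A. mpoly_subst h (f a) x)"
  by (induction A rule: infinite_finite_induct)
    (auto simp: mpoly_subst_zero mpoly_subst_add[OF assms])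

lemma mpoly_subst_single:
  assumes "unital_hom h"
  shows "mpoly_subst h (Poly_Mapping.single m c) x = h c * (\<Prod>i\<in>UNIV. x i ^ Poly_Mapping.lookup m i)"
  using mpoly_subst_superset[where S = "{m}" and h = h and p = "Poly_Mapping.single m c"]
  by (auto simp: unital_hom_0[OF assms])

lemma sum_monomials: "p = (\<Sum>m\<in>Poly_Mapping.keys p. Poly_Mapping.single m (Poly_Mapping.lookup p m))"
proof (rule poly_mapping_eqI)
  fix k
  show "Poly_Mapping.lookup p k =
      Poly_Mapping.lookup (\<Sum>m\<in>Poly_Mapping.keys p. Poly_Mapping.single m (Poly_Mapping.lookup p m)) k"
    by (auto simp: lookup_sum lookup_single when_def in_keys_iff)
qed

lemma mpoly_subst_mult:
  fixes p q :: "'q::finite real_mpoly"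
  assumes "unital_hom h"
  shows "mpoly_subst h (p * q) x = mpoly_subst h p x * mpoly_subst h q x"
proof -
  have "p * q = (\<Sum>m\<in>Poly_Mapping.keys p. \<Sum>n\<in>Poly_Mapping.keys q.
      Poly_Mapping.single (m + n) (Poly_Mapping.lookup p m * Poly_Mapping.lookup q n))"
    by (subst sum_monomials[of p], subst sum_monomials[of q]) (simp add: sum_product mult_single)
  then have "mpoly_subst h (p * q) x = (\<Sum>m\<in>Poly_Mapping.keys p. \<Sum>n\<in>Poly_Mapping.keys q.
      (h (Poly_Mapping.lookup p m) * (\<Prod>i\<in>UNIV. x i ^ Poly_Mapping.lookup m i)) *
      (h (Poly_Mapping.lookup q n) * (\<Prod>i\<in>UNIV. x i ^ Poly_Mapping.lookup n i)))"
    by (simp add: mpoly_subst_sum[OF assms] mpoly_subst_single[OF assms] unital_hom_mult[OF assms]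
        lookup_add power_add prod.distrib mult_ac)
  then show ?thesis
    by (simp add: mpoly_subst_def sum_product)
qed

lemma mpoly_subst_one: "unital_hom h \<Longrightarrow> mpoly_subst h 1 x = 1"
  using mpoly_subst_single[of h 0 1 x] by (simp add: unital_hom_1)

lemma unital_hom_mpoly_subst: "unital_hom h \<Longrightarrow> unital_hom (\<lambda>p. mpoly_subst h p x)"
  by (simp add: unital_hom_def mpoly_subst_add mpoly_subst_mult mpoly_subst_one)

lemma unital_hom_prod_mset: "unital_hom h \<Longrightarrow> h (prod_mset F) = (\<Prod>f\<in>#F. h f)"
  by (induction F) (auto simp: unital_hom_1 unital_hom_mult)

section \<open>Degrees and factors of multivariate polynomials\<close>

text \<open>Kronecker's trick: weights that are large enough, chosen one variable after the other, let a single
number encode an exponent vector, as in a positional number system with variable bases.\<close>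

lemma separating_weights:
  fixes M :: "('q \<Rightarrow> nat) set"
  assumes "finite I" "finite M"
  shows "\<exists>w::'q \<Rightarrow> nat. \<forall>m\<in>M. \<forall>n\<in>M. (\<Sum>i\<in>I. m i * w i) = (\<Sum>i\<in>I. n i * w i) \<longrightarrow> (\<forall>i\<in>I. m i = n i)"
  using \<open>finite I\<close>
proof induction
  case empty
  then show ?case by simp
next
  case (insert j I)
  then obtain w where w: "\<And>m n. m \<in> M \<Longrightarrow> n \<in> M \<Longrightarrow> (\<Sum>i\<in>I. m i * w i) = (\<Sum>i\<in>I. n i * w i) \<Longrightarrow> (\<forall>i\<in>I. m i = n i)"
    by blast
  define c where "c m = (\<Sum>i\<in>I. m i * w i)" for m :: "'q \<Rightarrow> nat"
  define B where "B = Suc (Max (c ` M))"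
  have B: "c m < B" if "m \<in> M" for m
    using that \<open>finite M\<close> by (auto simp: B_def less_Suc_eq_le)
  let ?w = "w(j := B)"
  have code: "(\<Sum>i\<in>insert j I. m i * ?w i) = c m + m j * B" for m
    using insert.hyps by (auto simp: c_def intro!: sum.cong)
  have "\<forall>i\<in>insert j I. m i = n i"
    if mn: "m \<in> M" "n \<in> M" and eq: "(\<Sum>i\<in>insert j I. m i * ?w i) = (\<Sum>i\<in>insert j I. n i * ?w i)" for m n
  proof -
    have e: "c m + m j * B = c n + n j * B"
      using eq by (simp only: code)
    have "(c m + m j * B) mod B = c m" "(c n + n j * B) mod B = c n"
      "(c m + m j * B) div B = m j" "(c n + n j * B) div B = n j"
      using B[OF mn(1)] B[OF mn(2)] by auto
    with e have "c m = c n" "m j = n j" by auto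
    then show ?thesis
      using w[OF mn] by (auto simp: c_def)
  qed
  then show ?case by blast
qed

definition weighted_sum :: "('q::finite \<Rightarrow> nat) \<Rightarrow> ('q \<Rightarrow>\<^sub>0 nat) \<Rightarrow> nat" where
  "weighted_sum w m = (\<Sum>i\<in>UNIV. Poly_Mapping.lookup m i * w i)"

lemma separating_weights_mpoly:
  fixes M :: "('q::finite \<Rightarrow>\<^sub>0 nat) set"
  assumes "finite M"
  shows "\<exists>w. inj_on (weighted_sum w) M"
proof -
  have "finite (Poly_Mapping.lookup ` M)"
    using assms by simp
  from separating_weights[OF finite this]
  obtain w where w: "\<And>m n. m \<in> Poly_Mapping.lookup ` M \<Longrightarrow> n \<in> Poly_Mapping.lookup ` M \<Longrightarrow>
      (\<Sum>i\<in>UNIV. m i * w i) = (\<Sum>i\<in>UNIV. n i * w i) \<Longrightarrow> \<forall>i\<in>UNIV. m i = n i"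
    by blast
  have "m = n" if "m \<in> M" "n \<in> M" "weighted_sum w m = weighted_sum w n" for m n
    using w[OF imageI[OF that(1)] imageI[OF that(2)] that(3)[unfolded weighted_sum_def]]
    by (intro poly_mapping_eqI) blast
  then show ?thesis
    by (intro exI[of _ w] inj_onI)
qed

text \<open>The variable \<open>i\<close> becomes \<open>X\<^bsup>w i\<^esup> Y\<close>, with \<open>X\<close> the inner and \<open>Y\<close> the outer variable.  Thus \<open>Y\<close>
records the total degree, while for separating weights \<open>X\<close> keeps distinct monomials apart.  This
transports questions about degree and homogeneity to an integral domain of univariate polynomials,
without any order on the variables.\<close>

definition kronecker :: "('q::finite \<Rightarrow> nat) \<Rightarrow> 'q real_mpoly \<Rightarrow> real poly poly" where
  "kronecker w p = mpoly_subst (\<lambda>c. [:[:c:]:]) p (\<lambda>i. monom (monom 1 (w i)) 1)"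

lemma prod_monom: "(\<Prod>i\<in>A. monom (c i) (d i)) = monom (\<Prod>i\<in>A. c i) (\<Sum>i\<in>A. d i)"
  by (induction A rule: infinite_finite_induct) (simp_all add: mult_monom)

lemma kronecker_altdef:
  "kronecker w p = (\<Sum>m\<in>Poly_Mapping.keys p.
     monom (monom (Poly_Mapping.lookup p m) (weighted_sum w m)) (monom_degree m))"
proof -
  have "[:[:c:]:] * (\<Prod>i\<in>UNIV. monom (monom 1 (w i)) 1 ^ Poly_Mapping.lookup m i) =
      monom (monom c (weighted_sum w m)) (monom_degree m)" for c :: real and m
  proof -
    have "monom (monom 1 (w i)) 1 ^ Poly_Mapping.lookup m i =
        monom (monom (1::real) (Poly_Mapping.lookup m i * w i)) (Poly_Mapping.lookup m i)" for i
      by (simp add: monom_power mult.commute)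
    then have "(\<Prod>i\<in>UNIV. monom (monom (1::real) (w i)) 1 ^ Poly_Mapping.lookup m i) =
        monom (monom 1 (weighted_sum w m)) (monom_degree m)"
      by (simp add: prod_monom weighted_sum_def monom_degree_def)
    then show ?thesis
      by (simp add: smult_monom)
  qed
  then show ?thesis
    by (simp only: kronecker_def mpoly_subst_def)
qed

lemma unital_hom_kronecker: "unital_hom (kronecker w)"
proof -
  have "unital_hom (\<lambda>c::real. [:[:c:]:])"
    by (auto simp: unital_hom_def pCons_one)
  from unital_hom_mpoly_subst[OF this] show ?thesis
    unfolding kronecker_def .
qed

lemma coeff_kronecker:
  assumes "inj_on (weighted_sum w) (Poly_Mapping.keys p)" "m \<in> Poly_Mapping.keys p"
  shows "coeff (coeff (kronecker w p) (monom_degree m)) (weighted_sum w m) = Poly_Mapping.lookup p m"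
proof -
  have "coeff (coeff (kronecker w p) (monom_degree m)) (weighted_sum w m) =
     (\<Sum>n\<in>Poly_Mapping.keys p. if m = n then Poly_Mapping.lookup p n else 0)"
    unfolding kronecker_altdef coeff_sum
    by (intro sum.cong) (use assms in \<open>auto simp: inj_on_def\<close>)
  then show ?thesis
    using assms by simp
qed

lemma coeff_kronecker_eq_0:
  assumes "\<And>m. m \<in> Poly_Mapping.keys p \<Longrightarrow> monom_degree m \<noteq> D"
  shows "coeff (kronecker w p) D = 0"
  unfolding kronecker_altdef coeff_sum by (intro sum.neutral) (use assms in auto)

lemma kronecker_coeff_nonzero:
  assumes "inj_on (weighted_sum w) (Poly_Mapping.keys p)" "m \<in> Poly_Mapping.keys p"
  shows "coeff (kronecker w p) (monom_degree m) \<noteq> 0"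
  using coeff_kronecker[OF assms] assms(2) by (auto simp: in_keys_iff)

lemma kronecker_nonzero:
  assumes "inj_on (weighted_sum w) (Poly_Mapping.keys p)" "p \<noteq> 0"
  shows "kronecker w p \<noteq> 0"
proof -
  obtain m where "m \<in> Poly_Mapping.keys p"
    using assms(2) by (metis all_not_in_conv keys_eq_empty)
  then show ?thesis
    using kronecker_coeff_nonzero[OF assms(1)] by fastforce
qed

lemma monom_degree_le_total_degree: "m \<in> Poly_Mapping.keys p \<Longrightarrow> monom_degree m \<le> total_degree p"
  by (simp add: total_degree_def)

lemma degree_kronecker:
  assumes "inj_on (weighted_sum w) (Poly_Mapping.keys p)"
  shows "degree (kronecker w p) = total_degree p"
proof (rule antisym)
  show "degree (kronecker w p) \<le> total_degree p"
  proof (rule degree_le, intro allI impI)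
    fix D assume "total_degree p < D"
    then show "coeff (kronecker w p) D = 0"
      using monom_degree_le_total_degree[of _ p] by (intro coeff_kronecker_eq_0) fastforce
  qed
  have "total_degree p \<in> insert 0 (monom_degree ` Poly_Mapping.keys p)"
    unfolding total_degree_def by (rule Max_in) auto
  then show "total_degree p \<le> degree (kronecker w p)"
    using kronecker_coeff_nonzero[OF assms] by (auto intro: le_degree)
qed

lemma common_weights:
  fixes p q :: "'q::finite real_mpoly"
  obtains w where "inj_on (weighted_sum w) (Poly_Mapping.keys p)"
    "inj_on (weighted_sum w) (Poly_Mapping.keys q)"
    "inj_on (weighted_sum w) (Poly_Mapping.keys (p * q))"
proof -
  let ?S = "Poly_Mapping.keys p \<union> Poly_Mapping.keys q \<union> Poly_Mapping.keys (p * q)"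
  have "finite ?S" by simp
  from separating_weights_mpoly[OF this] obtain w where w: "inj_on (weighted_sum w) ?S" ..
  show ?thesis
    by (rule that[of w]; rule inj_on_subset[OF w]; blast)
qed

lemma total_degree_mult:
  fixes p q :: "'q::finite real_mpoly"
  assumes "p \<noteq> 0" "q \<noteq> 0"
  shows "total_degree (p * q) = total_degree p + total_degree q"
proof -
  obtain w where w: "inj_on (weighted_sum w) (Poly_Mapping.keys p)"
    "inj_on (weighted_sum w) (Poly_Mapping.keys q)"
    "inj_on (weighted_sum w) (Poly_Mapping.keys (p * q))"
    by (rule common_weights[of p q])
  have "total_degree (p * q) = degree (kronecker w (p * q))"
    by (rule degree_kronecker[OF w(3), symmetric])
  also have "\<dots> = degree (kronecker w p * kronecker w q)"
    by (subst unital_hom_mult[OF unital_hom_kronecker]) (rule refl)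
  also have "\<dots> = degree (kronecker w p) + degree (kronecker w q)"
    by (rule degree_mult_eq[OF kronecker_nonzero[OF w(1) assms(1)] kronecker_nonzero[OF w(2) assms(2)]])
  also have "\<dots> = total_degree p + total_degree q"
    by (rule arg_cong2[where f = "(+)", OF degree_kronecker[OF w(1)] degree_kronecker[OF w(2)]])
  finally show ?thesis .
qed

text \<open>In the variable \<open>Y\<close> a nonzero homogeneous polynomial is a monomial, i.e. its lowest and highest
exponents agree.  Both are additive under products and the lowest is at most the highest, so they
agree for each factor as well.\<close>

lemma homogeneous_factor:
  fixes p q :: "'q::finite real_mpoly"
  assumes "homogeneous (p * q)" "p * q \<noteq> 0"
  shows "homogeneous p"
proof -
  obtain w where w: "inj_on (weighted_sum w) (Poly_Mapping.keys p)"
    "inj_on (weighted_sum w) (Poly_Mapping.keys q)"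
    "inj_on (weighted_sum w) (Poly_Mapping.keys (p * q))"
    by (rule common_weights[of p q])
  let ?k = "kronecker w"
  have "p \<noteq> 0" "q \<noteq> 0"
    using assms(2) by auto
  then have nz: "?k p \<noteq> 0" "?k q \<noteq> 0" "?k (p * q) \<noteq> 0"
    using kronecker_nonzero[OF w(1)] kronecker_nonzero[OF w(2)] kronecker_nonzero[OF w(3) assms(2)]
    by blast+
  obtain d where d: "\<And>m. m \<in> Poly_Mapping.keys (p * q) \<Longrightarrow> monom_degree m = d"
    using assms(1) by (auto simp: homogeneous_def)
  have "?k (p * q) = monom (coeff (?k (p * q)) d) d"
    using coeff_kronecker_eq_0[of "p * q" _ w] d by (auto simp: poly_eq_iff)
  moreover from this have "coeff (?k (p * q)) d \<noteq> 0"
    using nz(3) by auto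
  ultimately have "order 0 (?k (p * q)) = d" "degree (?k (p * q)) = d"
    by (metis order_0_monom, metis degree_monom_eq)
  moreover have mult: "?k (p * q) = ?k p * ?k q"
    by (rule unital_hom_mult[OF unital_hom_kronecker])
  moreover have "order 0 (?k p * ?k q) = order 0 (?k p) + order 0 (?k q)"
    using nz(3) by (intro order_mult) (simp only: mult not_False_eq_True)
  moreover have "degree (?k p * ?k q) = degree (?k p) + degree (?k q)"
    by (rule degree_mult_eq[OF nz(1,2)])
  ultimately have "order 0 (?k p) + order 0 (?k q) = degree (?k p) + degree (?k q)"
    by metis
  with order_degree[OF nz(1), of 0] order_degree[OF nz(2), of 0]
  have eq: "order 0 (?k p) = degree (?k p)" by linarith
  have "monom_degree m = degree (?k p)" if "m \<in> Poly_Mapping.keys p" for m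
  proof -
    have c: "coeff (?k p) (monom_degree m) \<noteq> 0"
      using kronecker_coeff_nonzero[OF w(1) that] .
    have "monom 1 (order 0 (?k p)) dvd ?k p"
      using monom_1_dvd_iff[OF nz(1)] by simp
    with c have "order 0 (?k p) \<le> monom_degree m"
      unfolding monom_1_dvd_iff' by (meson not_le)
    with eq le_degree[OF c] show ?thesis by simp
  qed
  then show ?thesis
    by (auto simp: homogeneous_def)
qed

lemma unit_of_total_degree_0:
  fixes p :: "'q::finite real_mpoly"
  assumes "total_degree p = 0" "p \<noteq> 0"
  shows "p dvd 1"
proof -
  have "m = 0" if "m \<in> Poly_Mapping.keys p" for m
    using monom_degree_le_total_degree[OF that] assms(1)
    by (auto simp: monom_degree_def intro: poly_mapping_eqI)
  with assms(2) have keys: "Poly_Mapping.keys p = {0}"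
    by (metis all_not_in_conv keys_eq_empty singletonI subsetI subset_singletonD)
  define c where "c = Poly_Mapping.lookup p 0"
  have "c \<noteq> 0"
    using keys by (auto simp: c_def simp flip: in_keys_iff)
  have "p = Poly_Mapping.single 0 c"
    using sum_monomials[of p] by (simp add: keys c_def)
  then have "p * Poly_Mapping.single 0 (1 / c) = 1"
    using \<open>c \<noteq> 0\<close> by (simp add: mult_single)
  then show ?thesis
    by (metis dvdI)
qed

lemma irreducible_factorization_exists:
  fixes p :: "'q::finite real_mpoly"
  assumes "p \<noteq> 0"
  shows "\<exists>c F. c dvd 1 \<and> (\<forall>g\<in>#F. irreducible g) \<and> p = c * prod_mset F"
  using assms
proof (induction "total_degree p" arbitrary: p rule: less_induct)
  case less
  consider "p dvd 1" | "irreducible p" | a b where "p = a * b" "\<not> a dvd 1" "\<not> b dvd 1"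
    using less.prems by (auto simp: irreducible_def)
  then show ?case
  proof cases
    case 1
    then show ?thesis by (intro exI[of _ p] exI[of _ "{#}"]) auto
  next
    case 2
    then show ?thesis by (intro exI[of _ 1] exI[of _ "{#p#}"]) auto
  next
    case (3 a b)
    then have nz: "a \<noteq> 0" "b \<noteq> 0"
      using less.prems by auto
    then have "total_degree a > 0" "total_degree b > 0"
      using 3 unit_of_total_degree_0 by auto
    then have "total_degree a < total_degree p" "total_degree b < total_degree p"
      using total_degree_mult[OF nz] 3 by auto
    with less.hyps nz obtain c F c' F' where
      "c dvd 1" "\<forall>g\<in>#F. irreducible g" "a = c * prod_mset F"
      "c' dvd 1" "\<forall>g\<in>#F'. irreducible g" "b = c' * prod_mset F'"
      by metis
    then show ?thesis
      using 3 mult_dvd_mono[of c 1 c' 1]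
      by (intro exI[of _ "c * c'"] exI[of _ "F + F'"]) (auto simp: mult_ac)
  qed
qed

section \<open>Univariate restrictions and roots\<close>

lemma mpoly_eval_of_real: "mpoly_subst complex_of_real p (\<lambda>i. of_real (x $ i)) = of_real (mpoly_eval p x)"
  unfolding mpoly_eval_def by (simp add: unital_hom_comp_subst[OF unital_hom_of_real])

lemma poly_mpoly_subst_line:
  fixes h :: "real \<Rightarrow> 'a::comm_ring_1"
  shows "poly (mpoly_subst (\<lambda>c. [:h c:]) p (\<lambda>i. [:w i, y i:])) b = mpoly_subst h p (\<lambda>i. w i + b * y i)"
  by (subst unital_hom_comp_subst[OF unital_hom_poly]) simp

lemma complex_poly_mpoly_subst_line:
  "poly (map_poly complex_of_real (mpoly_subst (\<lambda>c. [:c:]) p (\<lambda>i. [:w i, y i:]))) b =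
     mpoly_subst complex_of_real p (\<lambda>i. of_real (w i) + b * of_real (y i))"
proof -
  have 1: "map_poly complex_of_real [:c:] = [:of_real c:]"
    and 2: "map_poly complex_of_real [:a, c:] = [:of_real a, of_real c:]" for a c
    by (simp_all add: map_poly_pCons)
  show ?thesis
    by (simp only: unital_hom_comp_subst[OF unital_hom_complexify] 1 2 poly_mpoly_subst_line)
qed

lemma coeff_mult_bounded:
  fixes u v :: "'a::comm_ring_1 poly"
  assumes "degree u \<le> m" "degree v \<le> n"
  shows "coeff (u * v) (m + n) = coeff u m * coeff v n"
proof -
  have "coeff (u * v) (m + n) = (\<Sum>i\<le>m + n. if i = m then coeff u m * coeff v n else 0)"
    unfolding coeff_mult
  proof (rule sum.cong)
    fix i assume "i \<in> {..m + n}"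
    have "i < m \<or> i = m \<or> i > m" by auto
    then show "coeff u i * coeff v (m + n - i) = (if i = m then coeff u m * coeff v n else 0)"
      using assms by (auto simp: coeff_eq_0)
  qed simp
  then show ?thesis by simp
qed

lemma coeff_power_bounded:
  fixes u :: "'a::comm_ring_1 poly"
  assumes "degree u \<le> 1"
  shows "degree (u ^ n) \<le> n \<and> coeff (u ^ n) n = coeff u 1 ^ n"
proof (induction n)
  case (Suc n)
  have "degree (u * u ^ n) \<le> degree u + degree (u ^ n)"
    by (rule degree_mult_le)
  then show ?case
    using Suc assms coeff_mult_bounded[of u 1 "u ^ n" n] by simp
qed simp

lemma coeff_prod_bounded:
  fixes u :: "'i \<Rightarrow> 'a::comm_ring_1 poly"
  assumes "finite I" "\<And>i. i \<in> I \<Longrightarrow> degree (u i) \<le> n i"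
  shows "degree (\<Prod>i\<in>I. u i) \<le> (\<Sum>i\<in>I. n i) \<and> coeff (\<Prod>i\<in>I. u i) (\<Sum>i\<in>I. n i) = (\<Prod>i\<in>I. coeff (u i) (n i))"
  using assms
proof (induction I rule: finite_induct)
  case (insert j I)
  have "degree (u j * prod u I) \<le> degree (u j) + degree (prod u I)"
    by (rule degree_mult_le)
  moreover have "degree (u j) \<le> n j" "degree (prod u I) \<le> sum n I"
    using insert by auto
  moreover from this have "coeff (u j * prod u I) (n j + sum n I) = coeff (u j) (n j) * coeff (prod u I) (sum n I)"
    by (rule coeff_mult_bounded)
  ultimately show ?case
    using insert by (auto intro: order_trans add_mono)
qed simp

text \<open>Unlike \<^const>\<open>homogeneous\<close>, this names the degree; the zero polynomial is a form of every degree.\<close>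

definition form_of_degree :: "nat \<Rightarrow> 'q::finite real_mpoly \<Rightarrow> bool" where
  "form_of_degree d p \<longleftrightarrow> (\<forall>m\<in>Poly_Mapping.keys p. monom_degree m = d)"

lemma mpoly_subst_scale:
  assumes "form_of_degree d p"
  shows "mpoly_subst h p (\<lambda>i. c * x i) = c ^ d * mpoly_subst h p x"
  unfolding mpoly_subst_def sum_distrib_left
proof (rule sum.cong)
  fix m assume "m \<in> Poly_Mapping.keys p"
  then have "(\<Prod>i\<in>UNIV. c ^ Poly_Mapping.lookup m i) = c ^ d"
    using assms by (simp add: form_of_degree_def monom_degree_def flip: power_sum)
  then show "h (Poly_Mapping.lookup p m) * (\<Prod>i\<in>UNIV. (c * x i) ^ Poly_Mapping.lookup m i) =
    c ^ d * (h (Poly_Mapping.lookup p m) * (\<Prod>i\<in>UNIV. x i ^ Poly_Mapping.lookup m i))"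
    by (simp add: power_mult_distrib prod.distrib mult_ac)
qed simp

lemma mpoly_subst_line_degree:
  fixes h :: "real \<Rightarrow> 'a::comm_ring_1"
  assumes "form_of_degree d p"
  defines "L \<equiv> \<lambda>w y. mpoly_subst (\<lambda>c. [:h c:]) p (\<lambda>i. [:w i, y i:])"
  shows "degree (L w y) \<le> d" and "coeff (L w y) d = mpoly_subst h p y"
proof -
  have *: "degree (\<Prod>i\<in>UNIV. [:w i, y i:] ^ Poly_Mapping.lookup m i) \<le> d \<and>
      coeff (\<Prod>i\<in>UNIV. [:w i, y i:] ^ Poly_Mapping.lookup m i) d = (\<Prod>i\<in>UNIV. y i ^ Poly_Mapping.lookup m i)"
    if "m \<in> Poly_Mapping.keys p" for m
  proof -
    have lin: "degree ([:w i, y i:] ^ n) \<le> n" "coeff ([:w i, y i:] ^ n) n = y i ^ n" for i n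
      using coeff_power_bounded[of "[:w i, y i:]" n] by auto
    show ?thesis
      using coeff_prod_bounded[of UNIV "\<lambda>i. [:w i, y i:] ^ Poly_Mapping.lookup m i" "Poly_Mapping.lookup m"]
        assms(1) that lin by (simp add: form_of_degree_def monom_degree_def)
  qed
  have "degree ([:h c:] * u) \<le> d" if "degree u \<le> d" for c and u :: "'a poly"
    using degree_mult_le[of "[:h c:]" u] that by simp
  then show "degree (L w y) \<le> d"
    using * unfolding L_def mpoly_subst_def by (intro degree_sum_le) auto
  show "coeff (L w y) d = mpoly_subst h p y"
    using * by (auto simp: L_def mpoly_subst_def coeff_sum intro!: sum.cong)
qed

text \<open>A quantitative form of the continuity of roots: a polynomial of fixed degree and leading coefficient
that is small at \<open>b\<close> has a root near \<open>b\<close>.\<close>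

lemma poly_lower_bound_dist_roots:
  fixes Q :: "complex poly"
  assumes "0 \<le> c" "\<And>r. poly Q r = 0 \<Longrightarrow> c \<le> norm (b - r)"
  shows "norm (lead_coeff Q) * c ^ degree Q \<le> norm (poly Q b)"
proof (cases "Q = 0")
  case False
  then obtain A where A: "size A = degree Q" "Q = smult (lead_coeff Q) (\<Prod>x\<in>#A. [:-x, 1:])"
    using alg_closed_imp_factorization by blast
  have pr: "poly (\<Prod>x\<in>#B. [:-x, 1:]) z = (\<Prod>x\<in>#B. z - x)" for z :: complex and B
    by (induction B) (auto simp: algebra_simps)
  have "c \<le> norm (b - x)" if "x \<in># A" for x
  proof (rule assms(2))
    have "(\<Prod>x'\<in>#A. x - x') = 0"
      using that by (auto simp: prod_mset_zero_iff)
    then show "poly Q x = 0"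
      by (subst A(2)) (simp add: pr)
  qed
  then have "c ^ size A \<le> norm (\<Prod>x\<in>#A. b - x)"
    using \<open>0 \<le> c\<close> by (induction A) (auto simp: norm_mult intro!: mult_mono)
  moreover have "norm (poly Q b) = norm (lead_coeff Q) * norm (\<Prod>x\<in>#A. b - x)"
    by (subst A(2)) (simp add: pr norm_mult)
  ultimately show ?thesis
    by (simp add: A(1) mult_left_mono)
qed simp

lemma poly_complexify_of_real: "poly (map_poly complex_of_real u) (of_real x) = of_real (poly u x)"
  by (induction u) (simp_all add: map_poly_pCons)

text \<open>A product of factors \<open>X + b\<close> with \<open>b \<ge> 0\<close> has nonnegative coefficients, and its support is an
interval that ends at the degree; the second claim states this without mentioning the order at \<open>0\<close>.
Both properties pass from \<open>v\<close> to \<open>(X + b) v\<close>.\<close>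

lemma nonpos_rooted_coeffs:
  fixes u :: "real poly"
  assumes "lead_coeff u > 0"
    and "\<And>z. poly (map_poly complex_of_real u) z = 0 \<Longrightarrow> \<exists>b\<ge>0. z = - of_real b"
  shows "0 \<le> coeff u i" and "i < degree u \<Longrightarrow> 0 < coeff u i \<Longrightarrow> 0 < coeff u (Suc i)"
proof -
  have "(\<forall>i. 0 \<le> coeff u i) \<and> (\<forall>i<degree u. 0 < coeff u i \<longrightarrow> 0 < coeff u (Suc i))"
    using assms
  proof (induction "degree u" arbitrary: u)
    case 0
    have "0 \<le> coeff u i" for i
      using 0(1,2) by (cases "i = 0") (simp_all add: coeff_eq_0)
    then show ?case using 0(1) by simp
  next
    case (Suc n)
    have "degree (map_poly complex_of_real u) = Suc n"
      using Suc.hyps(2) by (simp add: degree_map_poly)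
    then have "\<not> constant (poly (map_poly complex_of_real u))"
      by (simp only: constant_degree)
    then obtain z where "poly (map_poly complex_of_real u) z = 0"
      using fundamental_theorem_of_algebra by blast
    with Suc.prems(2) obtain b where b: "b \<ge> 0" "poly (map_poly complex_of_real u) (of_real (- b)) = 0"
      by fastforce
    then have "poly u (- b) = 0"
      by (simp only: poly_complexify_of_real of_real_eq_0_iff)
    then obtain v where v: "u = [:b, 1:] * v"
      by (auto simp: poly_eq_0_iff_dvd)
    have "v \<noteq> 0"
      using v Suc.hyps by auto
    then have "degree u = Suc (degree v)"
      unfolding v by (subst degree_mult_eq) auto
    moreover have "lead_coeff v > 0"
      using Suc.prems(1) unfolding v lead_coeff_mult by simp
    moreover have "\<exists>c\<ge>0. z = - of_real c" if "poly (map_poly complex_of_real v) z = 0" for z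
    proof (rule Suc.prems(2))
      show "poly (map_poly complex_of_real u) z = 0"
        unfolding v unital_hom_mult[OF unital_hom_complexify] poly_mult that by simp
    qed
    ultimately have IH: "\<And>i. 0 \<le> coeff v i" "\<And>i. i < degree v \<Longrightarrow> 0 < coeff v i \<Longrightarrow> 0 < coeff v (Suc i)"
      using Suc.hyps(1)[of v] Suc.hyps(2) by auto
    have coeff: "coeff u i = b * coeff v i + (case i of 0 \<Rightarrow> 0 | Suc j \<Rightarrow> coeff v j)" for i
      by (simp add: v coeff_pCons)
    have "0 \<le> coeff u i" for i
      using IH(1) b(1) by (auto simp: coeff split: nat.split)
    moreover have "0 < coeff u (Suc i)" if "i < degree u" "0 < coeff u i" for i
    proof -
      have "0 < coeff v i"
      proof (rule ccontr)
        assume "\<not> ?thesis"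
        with IH(1)[of i] have "coeff v i = 0" by simp
        with \<open>0 < coeff u i\<close> obtain j where j: "i = Suc j" "0 < coeff v j"
          by (auto simp: coeff split: nat.splits)
        with IH(2)[of j] that(1) \<open>degree u = Suc (degree v)\<close> \<open>coeff v i = 0\<close> show False
          by auto
      qed
      then show ?thesis
        using IH(1)[of "Suc i"] b(1) by (auto simp: coeff intro: add_nonneg_pos)
    qed
    ultimately show ?case by blast
  qed
  then show "0 \<le> coeff u i" and "i < degree u \<Longrightarrow> 0 < coeff u i \<Longrightarrow> 0 < coeff u (Suc i)"
    by auto
qed

section \<open>Stability of hyperbolic forms\<close>

locale hyperbolic_form =
  fixes p :: "'q::finite real_mpoly" and e :: "real ^ 'q" and d :: nat
  assumes form: "form_of_degree d p" and hyperbolic: "hyperbolic p e"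
begin

abbreviation "P \<equiv> mpoly_subst complex_of_real p"
abbreviation "K \<equiv> hyperbolicity_cone p e"

lemma eval_scale: "mpoly_eval p (c *\<^sub>R x) = c ^ d * mpoly_eval p x"
  using mpoly_subst_scale[OF form, of "\<lambda>c. c" c "\<lambda>i. x $ i"] by (simp add: mpoly_eval_def)

lemma eval_e_pos: "mpoly_eval p e > 0"
  using hyperbolic by (simp add: hyperbolic_def)

lemma nonzero_off_real:
  assumes "Im z \<noteq> 0"
  shows "P (\<lambda>i. z * of_real (e $ i) + of_real (x $ i)) \<noteq> 0"
proof
  assume "P (\<lambda>i. z * of_real (e $ i) + of_real (x $ i)) = 0"
  then have "poly (map_poly complex_of_real (line_poly p e (- x))) z = 0"
    by (simp add: line_poly_def complex_poly_mpoly_subst_line add.commute)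
  then have "z \<in> \<real>"
    using hyperbolic by (auto simp: hyperbolic_def real_rooted_def)
  with assms show False
    by (simp add: complex_is_Real_iff)
qed

lemma in_cone_iff: "x \<in> K \<longleftrightarrow> (\<forall>t>0. mpoly_eval p (t *\<^sub>R e + x) \<noteq> 0)"
proof -
  have "mpoly_eval p (t *\<^sub>R e - x) = 0 \<longleftrightarrow> mpoly_eval p ((- t) *\<^sub>R e + x) = 0" for t
    using eval_scale[of "-1" "t *\<^sub>R e - x"] by (auto simp: algebra_simps)
  then have "x \<in> K \<longleftrightarrow> (\<forall>t. mpoly_eval p ((- t) *\<^sub>R e + x) = 0 \<longrightarrow> 0 \<le> t)"
    by (simp add: hyperbolicity_cone_def hyp_eigenvalues_def poly_line_poly)
  also have "\<dots> \<longleftrightarrow> (\<forall>t>0. mpoly_eval p (t *\<^sub>R e + x) \<noteq> 0)"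
    by (metis minus_minus neg_less_0_iff_less not_le)
  finally show ?thesis .
qed

text \<open>The set \<open>A\<close> of parameters \<open>s\<close> for which the polynomial in \<open>b\<close> has a root in the closed upper
half-plane is clopen in the unit interval.  It is open because roots depend continuously on \<open>s\<close>
and are never real, and closed by compactness; here the leading coefficient \<open>p y \<noteq> 0\<close> keeps roots
from escaping to infinity.  At \<open>s = 0\<close> the roots are \<open>\<i> \<alpha> / \<tau>\<close> with \<open>\<tau> < 0\<close>, so \<open>A\<close> is empty.\<close>

lemma no_crossing:
  fixes w :: "'q \<Rightarrow> complex"
  assumes "\<alpha> > 0"
    and y: "\<And>t. t \<ge> 0 \<Longrightarrow> mpoly_eval p (t *\<^sub>R e + y) \<noteq> 0"
    and real_nz: "\<And>s b::real. 0 \<le> s \<Longrightarrow> s \<le> 1 \<Longrightarrow>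
      P (\<lambda>i. \<i> * of_real (\<alpha> * e $ i) + of_real s * w i + of_real b * of_real (y $ i)) \<noteq> 0"
    and "Im b \<ge> 0"
  shows "P (\<lambda>i. \<i> * of_real (\<alpha> * e $ i) + w i + b * of_real (y $ i)) \<noteq> 0"
proof -
  define v where "v s i = \<i> * of_real (\<alpha> * e $ i) + of_real s * w i" for s :: real and i
  define F where "F s b = P (\<lambda>i. v s i + b * of_real (y $ i))" for s b
  \<comment> \<open>\<open>G\<close> is \<open>F\<close> in the coordinate \<open>u = 1 / b\<close> around infinity, up to the factor \<open>b ^ d\<close>.\<close>
  define G where "G s u = P (\<lambda>i. u * v s i + of_real (y $ i))" for s u
  have cont: "continuous_on UNIV (\<lambda>z. F (fst z) (snd z))" "continuous_on UNIV (\<lambda>z. G (fst z) (snd z))"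
    unfolding F_def G_def v_def mpoly_subst_def by (intro continuous_intros)+
  have FG: "F s b = b ^ d * G s (1 / b)" if "b \<noteq> 0" for s b
    using mpoly_subst_scale[OF form, of complex_of_real b "\<lambda>i. (1 / b) * v s i + of_real (y $ i)"] that
    by (simp add: F_def G_def distrib_left)
  have y0: "mpoly_eval p y \<noteq> 0"
    using y[of 0] by simp
  have G0: "G s 0 \<noteq> 0" for s
    using y0 by (simp add: G_def mpoly_eval_of_real)
  have F_real: "F s (of_real b) \<noteq> 0" if "0 \<le> s" "s \<le> 1" for s b
    using real_nz[OF that, of b] by (simp add: F_def v_def)
  define A where "A = {s\<in>{0..1}. \<exists>b. Im b \<ge> 0 \<and> F s b = 0}"
  have "0 \<notin> A"
  proof
    assume "0 \<in> A"
    then obtain b where b: "Im b \<ge> 0" "F 0 b = 0" by (auto simp: A_def)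
    have "b \<noteq> 0" using F_real[of 0 0] b by auto
    have "G 0 (1 / b) = 0" using FG[OF \<open>b \<noteq> 0\<close>] b \<open>b \<noteq> 0\<close> by simp
    then have *: "P (\<lambda>i. (\<i> * of_real \<alpha> / b) * of_real (e $ i) + of_real (y $ i)) = 0"
      by (simp add: G_def v_def mult_ac)
    with nonzero_off_real have "Im (\<i> * of_real \<alpha> / b) = 0" by blast
    then obtain \<tau> where \<tau>: "\<i> * of_real \<alpha> / b = of_real \<tau>"
      by (metis complex_is_Real_iff Reals_cases)
    have "complex_of_real (mpoly_eval p (\<tau> *\<^sub>R e + y)) = 0"
      using * unfolding \<tau> by (simp flip: mpoly_eval_of_real)
    then have "\<tau> < 0"
      using y[of \<tau>] by (metis not_le of_real_eq_0_iff)
    have "\<i> * of_real \<alpha> = of_real \<tau> * b"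
      using \<tau> \<open>b \<noteq> 0\<close> by (simp add: field_simps)
    from arg_cong[OF this, of Im] have "\<alpha> = \<tau> * Im b"
      by simp
    with \<open>\<alpha> > 0\<close> \<open>\<tau> < 0\<close> b(1) show False
      by (metis less_eq_real_def mult_nonpos_nonneg not_le)
  qed
  \<comment> \<open>Two charts cover the half-plane with infinity: \<open>A1\<close> comes from roots with \<open>norm b \<le> 1\<close>, \<open>A2\<close> from \<open>norm u \<le> 1\<close>.\<close>
  have "compact A"
  proof -
    define A1 where "A1 = fst ` (({0..1} \<times> (cball 0 1 \<inter> {b. Im b \<ge> 0})) \<inter> {z. F (fst z) (snd z) = 0})"
    define A2 where "A2 = fst ` (({0..1} \<times> (cball 0 1 \<inter> {b. Im b \<le> 0})) \<inter> {z. G (fst z) (snd z) = 0})"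
    have "compact A1" "compact A2"
      unfolding A1_def A2_def
      by (intro compact_continuous_image continuous_on_fst continuous_on_id compact_Int_closed
          compact_Times compact_Icc compact_cball closed_halfspace_Im_ge closed_halfspace_Im_le
          closed_Collect_eq cont continuous_on_const)+
    moreover have "A = A1 \<union> A2"
    proof safe
      fix s assume s: "s \<in> A" "s \<notin> A2"
      then obtain b where b: "Im b \<ge> 0" "F s b = 0" "0 \<le> s" "s \<le> 1" by (auto simp: A_def)
      have "norm b \<le> 1"
      proof (rule ccontr)
        assume n: "\<not> norm b \<le> 1"
        then have "b \<noteq> 0" by auto
        then have "G s (1 / b) = 0"
          using FG[of b s] b by simp
        moreover have "norm (1 / b) \<le> 1"
          using n \<open>b \<noteq> 0\<close> by (simp add: norm_divide divide_le_eq_1)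
        moreover have "Im (1 / b) \<le> 0"
          using b(1) by (simp add: Im_divide divide_nonpos_nonneg)
        ultimately have "(s, 1 / b) \<in> ({0..1} \<times> (cball 0 1 \<inter> {b. Im b \<le> 0})) \<inter> {z. G (fst z) (snd z) = 0}"
          using b by (simp del: norm_divide)
        then have "s \<in> A2"
          unfolding A2_def by (rule rev_image_eqI) simp
        with s show False by simp
      qed
      then have "(s, b) \<in> ({0..1} \<times> (cball 0 1 \<inter> {b. Im b \<ge> 0})) \<inter> {z. F (fst z) (snd z) = 0}"
        using b by simp
      then show "s \<in> A1"
        unfolding A1_def by (rule rev_image_eqI) simp
    next
      fix s assume "s \<in> A1"
      then show "s \<in> A" by (auto simp: A1_def A_def)
    next
      fix s assume "s \<in> A2"
      then obtain u where u: "0 \<le> s" "s \<le> 1" "Im u \<le> 0" "G s u = 0" by (auto simp: A2_def)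
      then have "u \<noteq> 0" using G0[of s] by auto
      then have "F s (1 / u) = 0" using FG[of "1 / u" s] u by simp
      moreover have "Im (1 / u) \<ge> 0"
        using u by (simp add: Im_divide divide_nonpos_nonneg)
      ultimately show "s \<in> A" using u by (auto simp: A_def)
    qed
    ultimately show ?thesis by auto
  qed
  have "openin (top_of_set {0..1}) A"
  proof (subst openin_subopen, intro ballI)
    fix s0 assume s0: "s0 \<in> A"
    then obtain b where b: "Im b \<ge> 0" "F s0 b = 0" "0 \<le> s0" "s0 \<le> 1" by (auto simp: A_def)
    have "Im b \<noteq> 0"
    proof
      assume "Im b = 0"
      then have "b = of_real (Re b)"
        by (simp add: complex_eq_iff)
      with b(2) have "F s0 (of_real (Re b)) = 0"
        by metis
      with F_real[OF b(3,4)] show False by blast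
    qed
    with b have "Im b > 0" by simp
    define c where "c = norm (of_real (mpoly_eval p y) :: complex) * Im b ^ d"
    have "c > 0" using y0 \<open>Im b > 0\<close> by (simp add: c_def)
    have far: "s \<in> A" if s: "0 \<le> s" "s \<le> 1" "norm (F s b) < c" for s
    proof (rule ccontr)
      assume "s \<notin> A"
      define Q where "Q = mpoly_subst (\<lambda>c. [:complex_of_real c:]) p (\<lambda>i. [:v s i, of_real (y $ i):])"
      have Q: "poly Q b = F s b" for b
        by (simp add: Q_def F_def poly_mpoly_subst_line)
      have top: "coeff Q d = of_real (mpoly_eval p y)"
        unfolding Q_def by (subst mpoly_subst_line_degree(2)[OF form]) (rule mpoly_eval_of_real)
      then have "degree Q \<ge> d"
        using y0 by (intro le_degree) simp
      moreover have "degree Q \<le> d"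
        unfolding Q_def by (rule mpoly_subst_line_degree(1)[OF form])
      ultimately have deg: "degree Q = d" by simp
      have "Im b \<le> norm (b - r)" if "poly Q r = 0" for r
      proof -
        have "Im r < 0"
          using that \<open>s \<notin> A\<close> s by (auto simp: Q A_def not_le)
        then show ?thesis
          using abs_Im_le_cmod[of "b - r"] by simp
      qed
      then have "norm (lead_coeff Q) * Im b ^ degree Q \<le> norm (poly Q b)"
        using \<open>Im b > 0\<close> by (intro poly_lower_bound_dist_roots) auto
      then have "c \<le> norm (F s b)"
        by (simp add: deg top Q c_def)
      with s show False by simp
    qed
    have "continuous_on UNIV (\<lambda>s. norm (F s b))"
      unfolding F_def v_def mpoly_subst_def by (intro continuous_intros)
    then have "open {s. norm (F s b) < c}"
      by (rule open_Collect_less) (intro continuous_intros)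
    then have "openin (top_of_set {0..1}) ({0..1} \<inter> {s. norm (F s b) < c})"
      by (rule openin_open_Int)
    moreover have "s0 \<in> {0..1} \<inter> {s. norm (F s b) < c}"
      using b \<open>c > 0\<close> by simp
    moreover have "{0..1} \<inter> {s. norm (F s b) < c} \<subseteq> A"
      using far by auto
    ultimately show "\<exists>T. openin (top_of_set {0..1}) T \<and> s0 \<in> T \<and> T \<subseteq> A"
      by blast
  qed
  moreover have "closedin (top_of_set {0..1}) A"
    using \<open>compact A\<close> by (intro closed_subset compact_imp_closed) (auto simp: A_def)
  moreover have "connected {0..1::real}"
    by (rule connected_Icc)
  ultimately have "A = {} \<or> A = {0..1}"
    unfolding connected_clopen by blast
  with \<open>0 \<notin> A\<close> have "A = {}" by auto
  then have "1 \<notin> A" by simp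
  with \<open>Im b \<ge> 0\<close> have "F 1 b \<noteq> 0"
    by (auto simp: A_def)
  then show ?thesis
    by (simp add: F_def v_def)
qed

text \<open>The complex directions \<open>w\<close> along which one cannot reach a zero from a point whose imaginary part
is a positive multiple of \<open>e\<close>.  Quantifying over real translations \<open>z\<close> and over the scaling \<open>s\<close>
makes the condition strong enough to absorb one cone element after the other in \<open>tame_add\<close>.\<close>

definition tame :: "('q \<Rightarrow> complex) \<Rightarrow> bool" where
  "tame w \<longleftrightarrow> (\<forall>\<alpha>>0. \<forall>s\<ge>0. \<forall>z::real ^ 'q.
     P (\<lambda>i. \<i> * of_real (\<alpha> * e $ i) + of_real (z $ i) + of_real s * w i) \<noteq> 0)"

lemma tameD:
  assumes "tame w" "\<alpha> > 0" "s \<ge> 0"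
  shows "P (\<lambda>i. \<i> * of_real (\<alpha> * e $ i) + of_real (z $ i) + of_real s * w i) \<noteq> 0"
  using assms by (simp add: tame_def)

lemma tame_0: "tame (\<lambda>i. 0)"
  unfolding tame_def
proof safe
  fix \<alpha> s :: real and z :: "real ^ 'q"
  assume "\<alpha> > 0" and eq: "P (\<lambda>i. \<i> * of_real (\<alpha> * e $ i) + of_real (z $ i) + of_real s * 0) = 0"
  have "P (\<lambda>i. (\<i> * of_real \<alpha>) * of_real (e $ i) + of_real (z $ i)) \<noteq> 0"
    by (rule nonzero_off_real) (use \<open>\<alpha> > 0\<close> in simp)
  with eq show False
    by (simp add: mult_ac)
qed

text \<open>The point \<open>y\<close> may lie on the boundary of the cone, whereas \<open>no_crossing\<close> wants it inside.  It is
moved to \<open>y + \<delta> e\<close>; the correction \<open>b' \<delta> e\<close> has a real part, absorbed into \<open>z\<close>, and an imaginary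
part, which is charged to \<open>\<alpha>\<close> and does not exhaust it for small \<open>\<delta>\<close>.\<close>

lemma tame_add:
  assumes "tame w" "y \<in> K" "Im b \<ge> 0"
  shows "tame (\<lambda>i. w i + b * of_real (y $ i))"
  unfolding tame_def
proof (intro allI impI)
  fix \<alpha> s :: real and z :: "real ^ 'q"
  assume \<alpha>: "\<alpha> > 0" and s: "s \<ge> 0"
  define b' where "b' = of_real s * b"
  have b': "Im b' \<ge> 0" using s assms(3) by (simp add: b'_def)
  define \<delta> where "\<delta> = \<alpha> / (2 * (1 + Im b'))"
  have \<delta>: "\<delta> > 0" using \<alpha> b' by (simp add: \<delta>_def)
  have "\<delta> * Im b' < \<delta> * (2 * (1 + Im b'))"
    using \<delta> b' by (intro mult_strict_left_mono) auto
  also have "\<dots> = \<alpha>"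
    using b' by (simp add: \<delta>_def)
  finally have "\<delta> * Im b' < \<alpha>" .
  define \<alpha>' where "\<alpha>' = \<alpha> - \<delta> * Im b'"
  have \<alpha>': "\<alpha>' > 0" using \<open>\<delta> * Im b' < \<alpha>\<close> by (simp add: \<alpha>'_def)
  define z' where "z' = z - (\<delta> * Re b') *\<^sub>R e"
  define y' where "y' = y + \<delta> *\<^sub>R e"
  have "P (\<lambda>i. \<i> * of_real (\<alpha>' * e $ i) + (of_real (z' $ i) + of_real s * w i) + b' * of_real (y' $ i)) \<noteq> 0"
  proof (rule no_crossing[OF \<alpha>' _ _ b'])
    fix t :: real assume "t \<ge> 0"
    have "mpoly_eval p ((t + \<delta>) *\<^sub>R e + y) \<noteq> 0"
      using \<open>y \<in> K\<close> \<open>t \<ge> 0\<close> \<delta> by (simp add: in_cone_iff)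
    then show "mpoly_eval p (t *\<^sub>R e + y') \<noteq> 0"
      by (simp add: y'_def algebra_simps)
  next
    fix r c :: real assume r: "0 \<le> r" "r \<le> 1"
    have "P (\<lambda>i. \<i> * of_real (\<alpha>' * e $ i) + of_real ((r *\<^sub>R z' + c *\<^sub>R y') $ i) + of_real (r * s) * w i) \<noteq> 0"
      by (rule tameD[OF \<open>tame w\<close> \<alpha>']) (use r s in simp)
    then show "P (\<lambda>i. \<i> * of_real (\<alpha>' * e $ i) + of_real r * (of_real (z' $ i) + of_real s * w i) +
        of_real c * of_real (y' $ i)) \<noteq> 0"
      by (simp add: algebra_simps)
  qed
  moreover have "\<i> * of_real (\<alpha>' * e $ i) + (of_real (z' $ i) + of_real s * w i) + b' * of_real (y' $ i) =
      \<i> * of_real (\<alpha> * e $ i) + of_real (z $ i) + of_real s * (w i + b * of_real (y $ i))" for i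
    by (simp add: complex_eq_iff \<alpha>'_def z'_def y'_def b'_def algebra_simps)
  ultimately show "P (\<lambda>i. \<i> * of_real (\<alpha> * e $ i) + of_real (z $ i) + of_real s * (w i + b * of_real (y $ i))) \<noteq> 0"
    by simp
qed

lemma stable:
  assumes "x \<in> K" "y \<in> K" "Im t > 0" "Im a \<ge> 0" "Im b \<ge> 0"
  shows "P (\<lambda>i. t * of_real (e $ i) + a * of_real (x $ i) + b * of_real (y $ i)) \<noteq> 0"
proof -
  have "tame (\<lambda>i. (0 + a * of_real (x $ i)) + b * of_real (y $ i))"
    by (intro tame_add tame_0 assms)
  then have "P (\<lambda>i. \<i> * of_real (Im t * e $ i) + of_real ((Re t *\<^sub>R e) $ i) +
      of_real 1 * ((0 + a * of_real (x $ i)) + b * of_real (y $ i))) \<noteq> 0"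
    by (rule tameD) (use assms(3) in simp_all)
  moreover have "\<i> * of_real (Im t * e $ i) + of_real ((Re t *\<^sub>R e) $ i) +
      of_real 1 * ((0 + a * of_real (x $ i)) + b * of_real (y $ i)) =
      t * of_real (e $ i) + a * of_real (x $ i) + b * of_real (y $ i)" for i
    by (simp add: complex_eq_iff)
  ultimately show ?thesis by (simp only: simp_thms)
qed

text \<open>Garding's convexity theorem: multiplying all arguments by \<open>\<i>\<close> turns a zero
at \<open>t e + x + y\<close> with \<open>t > 0\<close> into one that stability excludes.\<close>

lemma cone_add:
  assumes "x \<in> K" "y \<in> K"
  shows "x + y \<in> K"
  unfolding in_cone_iff
proof (intro allI impI notI)
  fix t :: real
  assume "t > 0" and 0: "mpoly_eval p (t *\<^sub>R e + (x + y)) = 0"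
  have "P (\<lambda>i. (\<i> * of_real t) * of_real (e $ i) + \<i> * of_real (x $ i) + \<i> * of_real (y $ i)) =
      P (\<lambda>i. \<i> * of_real ((t *\<^sub>R e + (x + y)) $ i))"
    by (simp add: algebra_simps)
  also have "\<dots> = 0"
    by (simp only: mpoly_subst_scale[OF form] mpoly_eval_of_real 0) simp
  finally show False
    using stable[OF assms, of "\<i> * of_real t" \<i> \<i>] \<open>t > 0\<close> by simp
qed

lemma cone_scale:
  assumes "x \<in> K" "c \<ge> 0"
  shows "c *\<^sub>R x \<in> K"
proof (cases "c = 0")
  case True
  then show ?thesis
    using eval_e_pos by (auto simp: in_cone_iff eval_scale)
next
  case False
  show ?thesis
    unfolding in_cone_iff
  proof (intro allI impI)
    fix t :: real assume "t > 0"
    then have "mpoly_eval p ((t / c) *\<^sub>R e + x) \<noteq> 0"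
      using assms False by (simp add: in_cone_iff)
    moreover have "t *\<^sub>R e + c *\<^sub>R x = c *\<^sub>R ((t / c) *\<^sub>R e + x)"
      using False by (simp add: algebra_simps)
    ultimately show "mpoly_eval p (t *\<^sub>R e + c *\<^sub>R x) \<noteq> 0"
      using False by (simp only: eval_scale) simp
  qed
qed

lemma cone_zero: "0 \<in> K"
  using eval_e_pos by (auto simp: in_cone_iff eval_scale)

lemma cone_sum: "(\<And>i. i \<in> I \<Longrightarrow> y i \<in> K) \<Longrightarrow> sum y I \<in> K"
  by (induction I rule: infinite_finite_induct) (auto simp: cone_zero cone_add)

lemma cone_diff_mono:
  assumes "x \<in> K" "x - \<epsilon> *\<^sub>R y \<in> K" "0 < \<delta>" "\<delta> \<le> \<epsilon>"
  shows "x - \<delta> *\<^sub>R y \<in> K"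
proof -
  have "(1 - \<delta> / \<epsilon>) *\<^sub>R x + (\<delta> / \<epsilon>) *\<^sub>R (x - \<epsilon> *\<^sub>R y) \<in> K"
    using assms by (intro cone_add cone_scale) auto
  moreover have "(1 - \<delta> / \<epsilon>) *\<^sub>R x + (\<delta> / \<epsilon>) *\<^sub>R (x - \<epsilon> *\<^sub>R y) = x - \<delta> *\<^sub>R y"
    using assms by (simp add: algebra_simps)
  ultimately show ?thesis by simp
qed

section \<open>The multiplicity of the eigenvalue zero\<close>

text \<open>The polynomial \<open>t \<mapsto> p (t e + x)\<close>, whose roots are the negated eigenvalues of \<open>x\<close>.  With this sign
the elements of the cone have nonnegative coefficients, and \<open>order 0 (char_poly x)\<close> is the
multiplicity of the eigenvalue \<open>0\<close>.\<close>

definition char_poly :: "real ^ 'q \<Rightarrow> real poly" where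
  "char_poly x = mpoly_subst (\<lambda>c. [:c:]) p (\<lambda>i. [:x $ i, e $ i:])"

lemma poly_char_poly: "poly (char_poly x) t = mpoly_eval p (t *\<^sub>R e + x)"
  unfolding char_poly_def
  by (subst poly_mpoly_subst_line[where h = "\<lambda>c. c"]) (simp add: mpoly_eval_def add.commute)

lemma degree_char_poly: "degree (char_poly x) = d"
  and lead_coeff_char_poly: "lead_coeff (char_poly x) = mpoly_eval p e"
proof -
  have top: "coeff (char_poly x) d = mpoly_eval p e"
    using mpoly_subst_line_degree(2)[OF form, of "\<lambda>c. c"] by (simp add: char_poly_def mpoly_eval_def)
  moreover have "degree (char_poly x) \<le> d"
    using mpoly_subst_line_degree(1)[OF form, of "\<lambda>c. c"] by (simp add: char_poly_def)
  moreover have "d \<le> degree (char_poly x)"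
    using top eval_e_pos by (intro le_degree) simp
  ultimately show "degree (char_poly x) = d" "lead_coeff (char_poly x) = mpoly_eval p e"
    by auto
qed

lemma char_poly_roots:
  assumes "x \<in> K" "poly (map_poly complex_of_real (char_poly x)) z = 0"
  shows "\<exists>b\<ge>0. z = - of_real b"
proof -
  have "P (\<lambda>i. z * of_real (e $ i) + of_real (x $ i)) = 0"
    using assms(2) by (simp add: char_poly_def complex_poly_mpoly_subst_line add.commute)
  with nonzero_off_real[of z x] have "Im z = 0" by blast
  then have z: "z = of_real (Re z)"
    by (simp add: complex_eq_iff)
  then have "poly (char_poly x) (Re z) = 0"
    using assms(2) poly_complexify_of_real[of "char_poly x" "Re z"] by simp
  with assms(1) have "\<not> Re z > 0"
    by (auto simp: poly_char_poly in_cone_iff)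
  with z show ?thesis
    by (intro exI[of _ "- Re z"]) auto
qed

lemma char_poly_coeffs:
  assumes "x \<in> K"
  shows "0 \<le> coeff (char_poly x) i"
    and "i < d \<Longrightarrow> 0 < coeff (char_poly x) i \<Longrightarrow> 0 < coeff (char_poly x) (Suc i)"
proof -
  have lead: "lead_coeff (char_poly x) > 0"
    using eval_e_pos by (simp only: lead_coeff_char_poly)
  show "0 \<le> coeff (char_poly x) i"
    using nonpos_rooted_coeffs(1)[OF lead char_poly_roots[OF assms]] .
  show "0 < coeff (char_poly x) (Suc i)" if "i < d" "0 < coeff (char_poly x) i"
    using nonpos_rooted_coeffs(2)[OF lead char_poly_roots[OF assms] _ that(2)] that(1)
    by (simp only: degree_char_poly)
qed

lemma eval_pos:
  assumes "x \<in> K" "t > 0"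
  shows "mpoly_eval p (t *\<^sub>R e + x) > 0"
proof -
  have "poly (char_poly x) t \<ge> 0"
    using char_poly_coeffs(1)[OF assms(1)] \<open>t > 0\<close>
    by (auto simp: poly_altdef intro!: sum_nonneg mult_nonneg_nonneg)
  with assms show ?thesis
    by (auto simp: poly_char_poly in_cone_iff less_le)
qed

lemma coeff_pos_from_order:
  assumes "x \<in> K" "order 0 (char_poly x) \<le> i" "i \<le> d"
  shows "coeff (char_poly x) i > 0"
  using assms(2,3)
proof (induction i rule: dec_induct)
  case base
  let ?u = "char_poly x"
  have "?u \<noteq> 0"
    using lead_coeff_char_poly[of x] eval_e_pos by auto
  have "coeff ?u (order 0 ?u) \<noteq> 0"
  proof
    assume 0: "coeff ?u (order 0 ?u) = 0"
    have "\<forall>k<order 0 ?u. coeff ?u k = 0"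
      using monom_1_dvd_iff[OF \<open>?u \<noteq> 0\<close>, of "order 0 ?u"] by (simp add: monom_1_dvd_iff')
    with 0 have "monom 1 (Suc (order 0 ?u)) dvd ?u"
      by (auto simp: monom_1_dvd_iff' less_Suc_eq)
    then show False
      by (simp add: monom_1_dvd_iff[OF \<open>?u \<noteq> 0\<close>])
  qed
  with char_poly_coeffs(1)[OF assms(1), of "order 0 ?u"] show ?case by simp
next
  case (step i)
  then show ?case
    using char_poly_coeffs(2)[OF assms(1), of i] by simp
qed

text \<open>For \<open>t > 0\<close> the roots \<open>s\<close> of \<open>p (t e + x + s y)\<close> are negative reals, so its coefficients have
the sign of its value at \<open>0\<close>.  For any other \<open>s\<close> there is a \<open>u\<close> in the open upper half-plane such
that \<open>u s\<close> lies in the closed one, and stability applies to the point multiplied by \<open>u\<close>.\<close>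

lemma directional_coeffs:
  assumes "x \<in> K" "y \<in> K" "t > 0"
  shows "0 \<le> coeff (mpoly_subst (\<lambda>c. [:c:]) p (\<lambda>i. [:(t *\<^sub>R e + x) $ i, y $ i:])) i"
proof -
  define S where "S = mpoly_subst (\<lambda>c. [:c:]) p (\<lambda>i. [:(t *\<^sub>R e + x) $ i, y $ i:])"
  have S0: "poly S 0 > 0"
    using eval_pos[OF assms(1,3)]
    by (simp add: S_def poly_mpoly_subst_line[where h = "\<lambda>c. c"] mpoly_eval_def)
  have nz: "poly (map_poly complex_of_real S) s \<noteq> 0" if u: "Im u > 0" "Im (u * s) \<ge> 0" for s u
  proof
    assume "poly (map_poly complex_of_real S) s = 0"
    then have 0: "P (\<lambda>i. of_real ((t *\<^sub>R e + x) $ i) + s * of_real (y $ i)) = 0"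
      by (simp only: S_def complex_poly_mpoly_subst_line)
    have "P (\<lambda>i. (u * of_real t) * of_real (e $ i) + u * of_real (x $ i) + (u * s) * of_real (y $ i)) =
        P (\<lambda>i. u * (of_real ((t *\<^sub>R e + x) $ i) + s * of_real (y $ i)))"
      by (simp add: algebra_simps)
    also have "\<dots> = 0"
      by (simp only: mpoly_subst_scale[OF form] 0) simp
    finally show False
      using stable[OF assms(1,2), of "u * of_real t" u "u * s"] u \<open>t > 0\<close> by simp
  qed
  have upper: "poly (map_poly complex_of_real S) s \<noteq> 0" if "Im s > 0" for s
  proof (rule nz)
    \<comment> \<open>A rotation by a small angle: \<open>1 + \<i> \<eta>\<close> must not push \<open>s\<close> below the real axis.\<close>
    define \<eta> where "\<eta> = Im s / (1 + \<bar>Re s\<bar>)"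
    have \<eta>: "\<eta> > 0" using that by (simp add: \<eta>_def add_pos_nonneg)
    then show "Im (Complex 1 \<eta>) > 0" by simp
    have "\<eta> * (- Re s) \<le> \<eta> * (1 + \<bar>Re s\<bar>)"
      using \<eta> by (intro mult_left_mono) auto
    also have "\<dots> = Im s"
      by (simp add: \<eta>_def)
    finally show "Im (Complex 1 \<eta> * s) \<ge> 0" by simp
  qed
  have roots: "\<exists>b\<ge>0. s = - of_real b" if 0: "poly (map_poly complex_of_real S) s = 0" for s
  proof -
    have "poly (map_poly complex_of_real S) (cnj s) = cnj (poly (map_poly complex_of_real S) s)"
      by (simp add: poly_altdef coeff_map_poly)
    with 0 have "\<not> Im (cnj s) > 0" "\<not> Im s > 0"
      using upper[of s] upper[of "cnj s"] by auto
    then have "Im s = 0" by simp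
    moreover have "\<not> Re s \<ge> 0"
      using nz[of \<i> s] 0 by auto
    ultimately show ?thesis
      by (intro exI[of _ "- Re s"]) (auto simp: complex_eq_iff)
  qed
  have "lead_coeff S > 0"
  proof (rule ccontr)
    assume "\<not> ?thesis"
    moreover have "S \<noteq> 0" using S0 by auto
    ultimately have "lead_coeff (- S) > 0"
      by (simp add: less_le)
    moreover have "\<exists>b\<ge>0. s = - of_real b" if "poly (map_poly complex_of_real (- S)) s = 0" for s
    proof (rule roots)
      have "map_poly complex_of_real (- S) = - map_poly complex_of_real S"
        by (simp add: poly_eq_iff coeff_map_poly)
      with that show "poly (map_poly complex_of_real S) s = 0" by simp
    qed
    ultimately have "0 \<le> coeff (- S) 0"
      by (rule nonpos_rooted_coeffs(1))
    with S0 show False by (simp add: poly_0_coeff_0)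
  qed
  then have "0 \<le> coeff S i"
    using roots by (rule nonpos_rooted_coeffs(1))
  then show ?thesis
    by (simp only: S_def)
qed

text \<open>The comparison holds coefficient by coefficient, since the order condition means that every
coefficient that occurs in the polynomial of \<open>y\<close> is positive in the polynomial of \<open>x\<close>.\<close>

lemma char_poly_dominated:
  assumes "x \<in> K" "y \<in> K" "order 0 (char_poly x) \<le> order 0 (char_poly y)"
  shows "\<exists>M>0. \<forall>t\<ge>0. poly (char_poly y) t \<le> M * poly (char_poly x) t"
proof -
  let ?u = "coeff (char_poly x)" and ?v = "coeff (char_poly y)"
  define M where "M = 1 + (\<Sum>i\<le>d. ?v i / ?u i)"
  have nn: "0 \<le> ?u i" "0 \<le> ?v i" for i
    using char_poly_coeffs(1) assms by auto
  have M: "M \<ge> 1" using nn by (simp add: M_def sum_nonneg)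
  have le: "?v i \<le> M * ?u i" if "i \<le> d" for i
  proof (cases "order 0 (char_poly x) \<le> i")
    case True
    then have "?u i > 0"
      using coeff_pos_from_order assms(1) that by blast
    have "?v i / ?u i \<le> (\<Sum>i\<le>d. ?v i / ?u i)"
      using nn that by (intro member_le_sum) auto
    then have "?v i / ?u i \<le> M" by (simp add: M_def)
    with \<open>?u i > 0\<close> show ?thesis by (simp add: pos_divide_le_eq)
  next
    case False
    have "char_poly y \<noteq> 0"
      using lead_coeff_char_poly[of y] eval_e_pos by auto
    then have "\<forall>k<order 0 (char_poly y). ?v k = 0"
      using monom_1_dvd_iff[of "char_poly y" "order 0 (char_poly y)"] by (simp add: monom_1_dvd_iff')
    then have "?v i = 0"
      using False assms(3) by simp
    then show ?thesis using M nn by simp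
  qed
  have "poly (char_poly y) t \<le> M * poly (char_poly x) t" if "t \<ge> 0" for t
  proof -
    have "(\<Sum>i\<le>d. ?v i * t ^ i) \<le> (\<Sum>i\<le>d. (M * ?u i) * t ^ i)"
      using le that by (intro sum_mono mult_right_mono) auto
    then show ?thesis
      by (simp add: poly_altdef degree_char_poly sum_distrib_left mult_ac)
  qed
  with M show ?thesis by (intro exI[of _ M]) auto
qed

text \<open>If the multiplicity did not drop, \<open>p (t e + x + y) \<le> M p (t e + x)\<close> would hold for all \<open>t \<ge> 0\<close>.
The coefficients of \<open>S s = p (t e + x + s y)\<close> being nonnegative, replacing \<open>s = 0\<close> by \<open>s = - \<epsilon>\<close>
costs at most \<open>\<epsilon> S 1 \<le> \<epsilon> M S 0 < S 0\<close>, uniformly in \<open>t\<close>.  Hence \<open>x - \<epsilon> y\<close> would stay in the cone.\<close>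

lemma order_drop:
  assumes "x \<in> K" "y \<in> K" and out: "\<And>\<epsilon>. \<epsilon> > 0 \<Longrightarrow> x - \<epsilon> *\<^sub>R y \<notin> K"
  shows "order 0 (char_poly (x + y)) < order 0 (char_poly x)"
proof (rule ccontr)
  assume "\<not> ?thesis"
  then obtain M where M: "M > 0" "\<And>t. t \<ge> 0 \<Longrightarrow> poly (char_poly (x + y)) t \<le> M * poly (char_poly x) t"
    using char_poly_dominated[OF assms(1) cone_add[OF assms(1,2)]] by auto
  define \<epsilon> where "\<epsilon> = 1 / (1 + M)"
  have \<epsilon>: "0 < \<epsilon>" "\<epsilon> \<le> 1" "\<epsilon> * M < 1" using M(1) by (auto simp: \<epsilon>_def field_simps)
  have "mpoly_eval p (t *\<^sub>R e + (x - \<epsilon> *\<^sub>R y)) > 0" if "t > 0" for t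
  proof -
    define S where "S = mpoly_subst (\<lambda>c. [:c:]) p (\<lambda>i. [:(t *\<^sub>R e + x) $ i, y $ i:])"
    have S: "poly S s = mpoly_eval p (t *\<^sub>R e + x + s *\<^sub>R y)" for s
      by (simp add: S_def poly_mpoly_subst_line[where h = "\<lambda>c. c"] mpoly_eval_def)
    have c: "0 \<le> coeff S k" for k
      unfolding S_def by (rule directional_coeffs[OF assms(1,2) that])
    define n where "n = degree S"
    have split: "poly S s = coeff S 0 + (\<Sum>k=1..n. coeff S k * s ^ k)" for s
      by (simp add: poly_altdef n_def atMost_atLeast0 sum.atLeast_Suc_atMost)
    have "- (\<Sum>k=1..n. coeff S k * (- \<epsilon>) ^ k) \<le> (\<Sum>k=1..n. \<epsilon> * coeff S k)"
      unfolding sum_negf[symmetric]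
    proof (rule sum_mono)
      fix k assume "k \<in> {1..n}"
      then have "\<epsilon> ^ k \<le> \<epsilon>"
        using \<epsilon> power_decreasing[of 1 k \<epsilon>] by simp
      moreover have "- ((- \<epsilon>) ^ k) \<le> \<epsilon> ^ k"
        using \<epsilon>(1) by (cases "even k") auto
      ultimately have "- ((- \<epsilon>) ^ k) \<le> \<epsilon>" by simp
      from mult_left_mono[OF this c] show "- (coeff S k * (- \<epsilon>) ^ k) \<le> \<epsilon> * coeff S k"
        by (simp add: mult.commute)
    qed
    also have "\<dots> \<le> \<epsilon> * poly S 1"
      using \<epsilon>(1) c[of 0] by (simp add: split sum_distrib_left[symmetric])
    also have "\<dots> \<le> \<epsilon> * (M * poly S 0)"
    proof (rule mult_left_mono)
      show "poly S 1 \<le> M * poly S 0"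
        using M(2)[of t] that by (simp add: S poly_char_poly add_ac)
    qed (use \<epsilon> in simp)
    also have "\<dots> < poly S 0"
      using mult_strict_right_mono[OF \<epsilon>(3), of "poly S 0"] eval_pos[OF assms(1) that] by (simp add: S mult_ac)
    finally have "0 < poly S (- \<epsilon>)"
      by (simp add: split[of "- \<epsilon>"] poly_0_coeff_0)
    then show ?thesis
      by (simp add: S algebra_simps)
  qed
  then have "x - \<epsilon> *\<^sub>R y \<in> K"
    unfolding in_cone_iff by fastforce
  with out \<epsilon>(1) show False by blast
qed

lemma chain_bound:
  assumes "\<And>j. j < n \<Longrightarrow> y j \<in> K"
    and "\<And>j \<epsilon>. j < n \<Longrightarrow> \<epsilon> > 0 \<Longrightarrow> (\<Sum>i<j. y i) - \<epsilon> *\<^sub>R y j \<notin> K"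
  shows "n \<le> d"
proof -
  have "order 0 (char_poly (\<Sum>i<j. y i)) + j \<le> d" if "j \<le> n" for j
    using that
  proof (induction j)
    case 0
    have "char_poly 0 \<noteq> 0"
      using lead_coeff_char_poly[of 0] eval_e_pos by auto
    then show ?case
      using order_degree[of "char_poly 0" 0] by (simp add: degree_char_poly)
  next
    case (Suc j)
    have "(\<Sum>i<j. y i) \<in> K"
      using assms(1) Suc.prems by (intro cone_sum) auto
    then have "order 0 (char_poly ((\<Sum>i<j. y i) + y j)) < order 0 (char_poly (\<Sum>i<j. y i))"
      using assms Suc.prems by (intro order_drop) auto
    with Suc show ?case by simp
  qed
  from this[of n] show ?thesis by simp
qed

end

section \<open>The cone of a product\<close>

lemma unital_hom_uminus: "unital_hom h \<Longrightarrow> h (- a) = - h a"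
  using unital_hom_add[of h a "- a"] by (simp add: unital_hom_0 eq_neg_iff_add_eq_0 add.commute)

lemma unital_hom_unit_nonzero:
  fixes h :: "'a::comm_ring_1 \<Rightarrow> 'b::comm_ring_1"
  assumes "unital_hom h" "c dvd 1"
  shows "h c \<noteq> 0"
proof -
  obtain c' where "1 = c * c'" using assms(2) by (auto elim: dvdE)
  then have "h c * h c' = 1"
    using assms(1) by (metis unital_hom_1 unital_hom_mult)
  then show ?thesis by auto
qed

lemma unital_hom_line_poly: "unital_hom (\<lambda>p. line_poly p e x)"
  unfolding line_poly_def by (rule unital_hom_mpoly_subst[OF unital_hom_pCons])

lemma unital_hom_mpoly_eval: "unital_hom (\<lambda>p. mpoly_eval p x)"
  unfolding mpoly_eval_def by (rule unital_hom_mpoly_subst[OF unital_hom_ident])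

lemma form_of_total_degree:
  assumes "homogeneous p"
  shows "form_of_degree (total_degree p) p"
proof -
  obtain d where d: "\<And>m. m \<in> Poly_Mapping.keys p \<Longrightarrow> monom_degree m = d"
    using assms by (auto simp: homogeneous_def)
  have "total_degree p = d" if "m \<in> Poly_Mapping.keys p" for m
  proof -
    have "monom_degree ` Poly_Mapping.keys p = {d}"
      using d that by auto
    then show ?thesis by (simp add: total_degree_def)
  qed
  with d show ?thesis by (auto simp: form_of_degree_def)
qed

text \<open>A factor \<open>f\<close> inherits homogeneity and real-rootedness from \<open>p\<close>, but \<open>f e\<close> may be negative; then
\<open>- f\<close> is used, which has the same eigenvalues.\<close>

lemma hyperbolicity_cone_factors:
  fixes p :: "'q::finite real_mpoly"
  assumes hom: "homogeneous p" and hyp: "hyperbolic p e"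
    and deg: "\<And>f. irreducible_factor f p \<Longrightarrow> total_degree f \<le> k"
  shows "\<exists>G. finite G \<and> (\<forall>g\<in>G. \<exists>d\<le>k. hyperbolic_form g e d) \<and>
    hyperbolicity_cone p e = (\<Inter>g\<in>G. hyperbolicity_cone g e)"
proof -
  have pe: "mpoly_eval p e > 0"
    using hyp by (simp add: hyperbolic_def)
  then have "p \<noteq> 0"
    by (auto simp: unital_hom_0[OF unital_hom_mpoly_eval])
  then obtain c F where c: "c dvd 1" and F: "\<forall>g\<in>#F. irreducible g" and p: "p = c * prod_mset F"
    using irreducible_factorization_exists by blast
  define sgn_normal where "sgn_normal f = (if mpoly_eval f e > 0 then f else - f)" for f
  have roots_normal: "poly (line_poly (sgn_normal f) e x) t = 0 \<longleftrightarrow> poly (line_poly f e x) t = 0" for f x t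
    by (simp add: sgn_normal_def unital_hom_uminus[OF unital_hom_line_poly])
  have factor: "hyperbolic_form (sgn_normal f) e (total_degree f) \<and> total_degree f \<le> k" if f: "f \<in># F" for f
  proof -
    obtain F' where "F = add_mset f F'"
      using multi_member_split[OF f] by blast
    then obtain q where q: "p = f * q"
      using p by (metis mult.left_commute prod_mset.add_mset)
    have "homogeneous f"
      using hom \<open>p \<noteq> 0\<close> unfolding q by (rule homogeneous_factor)
    then have "form_of_degree (total_degree f) (sgn_normal f)"
      using form_of_total_degree by (auto simp: sgn_normal_def form_of_degree_def)
    moreover have "mpoly_eval (sgn_normal f) e > 0"
      using pe by (auto simp: q unital_hom_mult[OF unital_hom_mpoly_eval] sgn_normal_def
          unital_hom_uminus[OF unital_hom_mpoly_eval] zero_less_mult_iff)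
    moreover have "real_rooted (line_poly (sgn_normal f) e x)" for x
      unfolding real_rooted_def
    proof (intro allI impI)
      fix z assume "poly (map_poly complex_of_real (line_poly (sgn_normal f) e x)) z = 0"
      then have "poly (map_poly complex_of_real (line_poly f e x)) z = 0"
        by (simp add: sgn_normal_def unital_hom_uminus[OF unital_hom_line_poly]
            unital_hom_uminus[OF unital_hom_complexify] split: if_splits)
      then have "poly (map_poly complex_of_real (line_poly p e x)) z = 0"
        by (simp add: q unital_hom_mult[OF unital_hom_line_poly] unital_hom_mult[OF unital_hom_complexify])
      then show "z \<in> \<real>"
        using hyp by (simp add: hyperbolic_def real_rooted_def)
    qed
    moreover have "total_degree f \<le> k"
      using deg[of f] c F p f unfolding irreducible_factor_def by blast
    ultimately show ?thesis
      by (simp add: hyperbolic_form_def hyperbolic_def)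
  qed
  have "poly (line_poly p e x) t = 0 \<longleftrightarrow> (\<exists>f\<in>#F. poly (line_poly f e x) t = 0)" for x t
  proof -
    have hom: "unital_hom (\<lambda>q. poly (line_poly q e x) t)"
      by (rule unital_hom_comp[OF unital_hom_poly unital_hom_line_poly])
    have "poly (line_poly p e x) t = poly (line_poly c e x) t * (\<Prod>f\<in>#F. poly (line_poly f e x) t)"
      unfolding p unital_hom_mult[OF hom] unital_hom_prod_mset[OF hom] ..
    then show ?thesis
      using unital_hom_unit_nonzero[OF hom c] by (auto simp: prod_mset_zero_iff)
  qed
  then have "hyperbolicity_cone p e = (\<Inter>g\<in>sgn_normal ` set_mset F. hyperbolicity_cone g e)"
    by (auto simp: hyperbolicity_cone_def hyp_eigenvalues_def roots_normal)
  with factor show ?thesis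
    by (intro exI[of _ "sgn_normal ` set_mset F"]) auto
qed

text \<open>The admissible \<open>\<epsilon>\<close> of each factor form an interval at \<open>0\<close>, and there are finitely many factors; if all
these intervals were nondegenerate, their intersection would be so too.\<close>

lemma persistent_exit:
  fixes x :: "real ^ 'q::finite"
  assumes "finite G" and G: "\<And>g. g \<in> G \<Longrightarrow> \<exists>d. hyperbolic_form g e d"
    and x: "x \<in> (\<Inter>g\<in>G. hyperbolicity_cone g e)"
    and out: "\<And>\<epsilon>. \<epsilon> > 0 \<Longrightarrow> x - \<epsilon> *\<^sub>R y \<notin> (\<Inter>g\<in>G. hyperbolicity_cone g e)"
  shows "\<exists>g\<in>G. \<forall>\<epsilon>>0. x - \<epsilon> *\<^sub>R y \<notin> hyperbolicity_cone g e"
proof (rule ccontr)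
  assume "\<not> ?thesis"
  then obtain r where r: "\<And>g. g \<in> G \<Longrightarrow> r g > 0 \<and> x - r g *\<^sub>R y \<in> hyperbolicity_cone g e"
    by metis
  define \<delta> where "\<delta> = Min (insert 1 (r ` G))"
  have "\<delta> > 0"
    using r \<open>finite G\<close> by (simp add: \<delta>_def)
  have "x - \<delta> *\<^sub>R y \<in> hyperbolicity_cone g e" if g: "g \<in> G" for g
  proof -
    obtain d where "hyperbolic_form g e d" using G g by blast
    moreover have "\<delta> \<le> r g"
      using g \<open>finite G\<close> by (simp add: \<delta>_def)
    ultimately show ?thesis
      using hyperbolic_form.cone_diff_mono[of g e d x "r g" y \<delta>] r[OF g] x g \<open>\<delta> > 0\<close> by blast
  qed
  with out[OF \<open>\<delta> > 0\<close>] show False by blast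
qed

section \<open>Rank-one matrices on the moment curve\<close>

definition outer_square :: "real ^ 'm \<Rightarrow> real ^ 'm ^ 'm" where
  "outer_square v = (\<chi> i j. v $ i * v $ j)"

lemma quadratic_form_outer_square: "u \<bullet> (outer_square v *v u) = (u \<bullet> v)\<^sup>2"
  by (simp add: outer_square_def inner_vec_def matrix_vector_mult_def power2_eq_square
      sum_product sum_distrib_left mult_ac)

lemma outer_square_psd: "outer_square v \<in> psd_cone"
  by (auto simp: psd_cone_def sym_matrices_def quadratic_form_outer_square)
     (simp add: outer_square_def transpose_def vec_eq_iff mult.commute)

text \<open>For \<open>v n = (1, n, \<dots>, n\<^sup>k)\<close> the inner product with \<open>u\<close> is the value at \<open>n\<close> of the polynomial with
coefficient vector \<open>u\<close>, so the polynomial with root set \<open>W\<close> provides \<open>u\<close>.\<close>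

lemma moment_curve_neighborly:
  assumes "CARD('m::finite) = k + 1"
  shows "\<exists>v :: nat \<Rightarrow> real ^ 'm. \<forall>W. finite W \<and> card W = k \<longrightarrow> (\<exists>u. \<forall>n. u \<bullet> v n = 0 \<longleftrightarrow> n \<in> W)"
proof -
  obtain idx :: "'m \<Rightarrow> nat" where idx: "bij_betw idx UNIV {0..<k + 1}"
    using ex_bij_betw_finite_nat[of "UNIV :: 'm set"] assms by auto
  define v :: "nat \<Rightarrow> real ^ 'm" where "v n = (\<chi> i. real n ^ idx i)" for n
  have "\<exists>u. \<forall>n. u \<bullet> v n = 0 \<longleftrightarrow> n \<in> W" if W: "finite W" "card W = k" for W
  proof -
    define Q where "Q = (\<Prod>w\<in>W. [:- real w, 1:])"
    have degQ: "degree Q = k"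
      unfolding Q_def by (subst degree_prod_sum_eq) (use W in auto)
    define u :: "real ^ 'm" where "u = (\<chi> i. coeff Q (idx i))"
    have "u \<bullet> v n = (\<Sum>i\<in>UNIV. coeff Q (idx i) * real n ^ idx i)" for n
      by (simp add: u_def v_def inner_vec_def)
    also have "\<dots> n = (\<Sum>j\<in>{0..<k + 1}. coeff Q j * real n ^ j)" for n
      using sum.reindex_bij_betw[OF idx, of "\<lambda>j. coeff Q j * real n ^ j"] by simp
    also have "\<dots> n = poly Q (real n)" for n
      by (simp add: poly_altdef degQ atLeast0LessThan lessThan_Suc_atMost)
    also have "\<dots> n = (\<Prod>w\<in>W. real n - real w)" for n
      by (simp add: Q_def poly_prod)
    finally have "u \<bullet> v n = 0 \<longleftrightarrow> n \<in> W" for n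
      using W by auto
    then show ?thesis by blast
  qed
  then show ?thesis by blast
qed

section \<open>Extracting a long chain by Ramsey's theorem\<close>

text \<open>The assumption speaks of sets of exactly \<open>k\<close> points, while the chain needs initial sums of
\<open>j \<le> k\<close> points.  The first \<open>k\<close> members of the monochromatic set serve as padding: adding
\<open>k - j\<close> of them to an initial sum stays inside the cone of the factor, so a violation by the
padded sum is a violation by the initial sum.  Only the colour of (set, maximum) pairs is
controlled, which is why the padding is taken from the bottom.\<close>

lemma uniform_chain_in_factor:
  fixes Y :: "nat \<Rightarrow> real ^ 'q::finite"
  assumes "finite G" and G: "\<And>g. g \<in> G \<Longrightarrow> \<exists>d. hyperbolic_form g e d"
    and Y: "\<And>n. Y n \<in> (\<Inter>g\<in>G. hyperbolicity_cone g e)"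
    and out: "\<And>W n \<epsilon>. finite W \<Longrightarrow> card W = k \<Longrightarrow> n \<notin> W \<Longrightarrow> \<epsilon> > 0 \<Longrightarrow>
      sum Y W - \<epsilon> *\<^sub>R Y n \<notin> (\<Inter>g\<in>G. hyperbolicity_cone g e)"
  shows "\<exists>g\<in>G. \<exists>y. (\<forall>j. y j \<in> hyperbolicity_cone g e) \<and>
    (\<forall>j\<le>k. \<forall>\<epsilon>>0. (\<Sum>i<j. y i) - \<epsilon> *\<^sub>R y j \<notin> hyperbolicity_cone g e)"
proof -
  obtain gs where gs: "set gs = G"
    using finite_list[OF \<open>finite G\<close>] by blast
  have sum_in: "sum Y W \<in> hyperbolicity_cone g e" if g: "g \<in> G" for g W
  proof -
    obtain d where "hyperbolic_form g e d" using G g by blast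
    then show ?thesis
      using Y g by (intro hyperbolic_form.cone_sum) auto
  qed
  define bad where "bad X i \<longleftrightarrow> (\<forall>\<epsilon>>0. sum Y (X - {Max X}) - \<epsilon> *\<^sub>R Y (Max X) \<notin> hyperbolicity_cone (gs ! i) e)"
    for X i
  have "\<exists>i<length gs. bad X i" if X: "finite X" "card X = k + 1" for X
  proof -
    have "Max X \<in> X" using X by (intro Max_in) auto
    then have "card (X - {Max X}) = k" using X by simp
    then have "\<exists>g\<in>G. \<forall>\<epsilon>>0. sum Y (X - {Max X}) - \<epsilon> *\<^sub>R Y (Max X) \<notin> hyperbolicity_cone g e"
      using X sum_in by (intro persistent_exit[OF \<open>finite G\<close> G] out) auto
    then show ?thesis
      unfolding bad_def gs[symmetric] by (metis in_set_conv_nth)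
  qed
  then obtain colour where colour: "\<And>X. finite X \<Longrightarrow> card X = k + 1 \<Longrightarrow> colour X < length gs \<and> bad X (colour X)"
    by metis
  have "\<exists>Z i. Z \<subseteq> UNIV \<and> infinite Z \<and> i < length gs \<and>
      (\<forall>X. X \<subseteq> Z \<and> finite X \<and> card X = k + 1 \<longrightarrow> colour X = i)"
    by (rule Ramsey) (use colour in auto)
  then obtain Z i where Z: "infinite Z" and i: "i < length gs"
    and mono: "\<And>X. X \<subseteq> Z \<Longrightarrow> finite X \<Longrightarrow> card X = k + 1 \<Longrightarrow> bad X i"
    using colour by metis
  define g where "g = gs ! i"
  have "g \<in> G" using i gs by (auto simp: g_def)
  then obtain d where form: "hyperbolic_form g e d" using G by blast
  define E where "E = enumerate Z"
  have E_less: "E m < E n \<longleftrightarrow> m < n" for m n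
    using Z by (simp add: E_def)
  have E: "E n \<in> Z" for n
    using Z by (simp add: E_def enumerate_in_set)
  have E_inj: "E m = E n \<longleftrightarrow> m = n" for m n
    using E_less[of m n] E_less[of n m] by (metis less_irrefl neq_iff)
  define y where "y j = Y (E (k + j))" for j
  have "(\<Sum>i<j. y i) - \<epsilon> *\<^sub>R y j \<notin> hyperbolicity_cone g e" if j: "j \<le> k" and "\<epsilon> > 0" for j \<epsilon>
  proof
    assume inside: "(\<Sum>i<j. y i) - \<epsilon> *\<^sub>R y j \<in> hyperbolicity_cone g e"
    define I where "I = {..<k - j} \<union> (\<lambda>i. k + i) ` {..<j}"
    define W where "W = E ` I"
    have sum_I: "sum f I = (\<Sum>i<k - j. f i) + (\<Sum>i<j. f (k + i))" for f :: "nat \<Rightarrow> 'c::comm_monoid_add"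
      unfolding I_def by (subst sum.union_disjoint) (auto simp: sum.reindex)
    have inj: "inj_on E I" using E_inj by (auto simp: inj_on_def)
    have "finite I" by (simp add: I_def)
    have "card I = k"
      using sum_I[of "\<lambda>_. 1::nat"] j by simp
    then have W: "finite W" "card W = k"
      using \<open>finite I\<close> inj by (auto simp: W_def card_image)
    have less: "w < E (k + j)" if "w \<in> W" for w
      using that E_less by (auto simp: W_def I_def)
    define X where "X = insert (E (k + j)) W"
    have X: "Max X = E (k + j)" "X - {Max X} = W" "finite X" "card X = k + 1" "X \<subseteq> Z"
    proof -
      show max: "Max X = E (k + j)"
        unfolding X_def using W less by (intro Max_eqI) (auto intro: less_imp_le)
      show "X - {Max X} = W" "card X = k + 1"
        unfolding max using W less by (auto simp: X_def card_insert_if)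
      show "finite X" "X \<subseteq> Z"
        using W E by (auto simp: X_def W_def)
    qed
    have "sum Y W - \<epsilon> *\<^sub>R Y (E (k + j)) = (\<Sum>i<k - j. Y (E i)) + ((\<Sum>i<j. y i) - \<epsilon> *\<^sub>R y j)"
      unfolding W_def sum.reindex[OF inj] sum_I by (simp add: y_def)
    moreover have "(\<Sum>i<k - j. Y (E i)) \<in> hyperbolicity_cone g e"
      using Y \<open>g \<in> G\<close> by (intro hyperbolic_form.cone_sum[OF form]) auto
    ultimately have "sum Y W - \<epsilon> *\<^sub>R Y (E (k + j)) \<in> hyperbolicity_cone g e"
      using inside hyperbolic_form.cone_add[OF form] by simp
    with mono[OF X(5,3,4)] \<open>\<epsilon> > 0\<close> show False
      unfolding bad_def X(2) unfolding X(1) g_def by blast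
  qed
  moreover have "y j \<in> hyperbolicity_cone g e" for j
    using Y \<open>g \<in> G\<close> by (auto simp: y_def)
  ultimately show ?thesis
    using \<open>g \<in> G\<close> by blast
qed

theorem mainTheorem4:
  fixes k :: nat
    and p :: "'q::finite real_mpoly"
    and e :: "real ^ 'q"
  assumes "k \<ge> 1"
    and "CARD('m::finite) = k + 1"
    and "homogeneous p"
    and "hyperbolic p e"
    and "\<And>f. irreducible_factor f p \<Longrightarrow> total_degree f \<le> k"
  shows "\<not> has_lift sym_matrices (psd_cone :: (real ^ 'm ^ 'm) set) (hyperbolicity_cone p e)"
proof
  assume "has_lift sym_matrices (psd_cone :: (real ^ 'm ^ 'm) set) (hyperbolicity_cone p e)"
  then obtain f :: "real ^ 'q \<Rightarrow> real ^ 'm ^ 'm" and L where f: "linear f" and L: "subspace L"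
    and lift: "psd_cone = f ` (hyperbolicity_cone p e \<inter> L)"
    unfolding has_lift_def by blast
  obtain G where "finite G" and G: "\<And>g. g \<in> G \<Longrightarrow> \<exists>d\<le>k. hyperbolic_form g e d"
    and cone: "hyperbolicity_cone p e = (\<Inter>g\<in>G. hyperbolicity_cone g e)"
    using hyperbolicity_cone_factors[OF assms(3-5)] by blast
  obtain v :: "nat \<Rightarrow> real ^ 'm"
    where v: "\<And>W. finite W \<Longrightarrow> card W = k \<Longrightarrow> \<exists>u. \<forall>n. u \<bullet> v n = 0 \<longleftrightarrow> n \<in> W"
    using moment_curve_neighborly[OF assms(2)] by blast
  have "\<exists>y. y \<in> hyperbolicity_cone p e \<inter> L \<and> f y = outer_square (v n)" for n
    using outer_square_psd[of "v n"] unfolding lift by (metis imageE)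
  then obtain Y where Y: "\<And>n. Y n \<in> hyperbolicity_cone p e" "\<And>n. Y n \<in> L"
    and fY: "\<And>n. f (Y n) = outer_square (v n)"
    by (metis IntE)
  have out: "sum Y W - \<epsilon> *\<^sub>R Y n \<notin> hyperbolicity_cone p e"
    if W: "finite W" "card W = k" and "n \<notin> W" "\<epsilon> > 0" for W n \<epsilon>
  proof
    assume "sum Y W - \<epsilon> *\<^sub>R Y n \<in> hyperbolicity_cone p e"
    moreover have "sum Y W - \<epsilon> *\<^sub>R Y n \<in> L"
      using Y(2) L by (intro subspace_diff subspace_sum subspace_scale) auto
    ultimately have "f (sum Y W - \<epsilon> *\<^sub>R Y n) \<in> psd_cone"
      unfolding lift by blast
    moreover obtain u where u: "\<And>n. u \<bullet> v n = 0 \<longleftrightarrow> n \<in> W"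
      using v[OF W] by blast
    ultimately have "0 \<le> u \<bullet> (f (sum Y W - \<epsilon> *\<^sub>R Y n) *v u)"
      by (simp add: psd_cone_def)
    moreover have "linear (\<lambda>A :: real ^ 'm ^ 'm. u \<bullet> (A *v u))"
      by (auto intro!: linearI simp: matrix_vector_mult_add_rdistrib inner_add_right
          scaleR_matrix_vector_assoc[symmetric])
    then have lin: "linear (\<lambda>x. u \<bullet> (f x *v u))"
      using linear_compose[OF f] by (simp add: o_def)
    have "u \<bullet> (f (sum Y W - \<epsilon> *\<^sub>R Y n) *v u) = (\<Sum>w\<in>W. (u \<bullet> v w)\<^sup>2) - \<epsilon> * (u \<bullet> v n)\<^sup>2"
      by (simp add: linear_diff[OF lin] linear_sum[OF lin] linear_scale[OF lin] fY quadratic_form_outer_square)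
    moreover have "(\<Sum>w\<in>W. (u \<bullet> v w)\<^sup>2) = 0"
      using u by (intro sum.neutral) simp
    moreover have "\<epsilon> * (u \<bullet> v n)\<^sup>2 > 0"
      using u \<open>n \<notin> W\<close> \<open>\<epsilon> > 0\<close> by simp
    ultimately show False by linarith
  qed
  obtain g y where "g \<in> G" and y: "\<And>j. y j \<in> hyperbolicity_cone g e"
    "\<And>j \<epsilon>. j \<le> k \<Longrightarrow> \<epsilon> > 0 \<Longrightarrow> (\<Sum>i<j. y i) - \<epsilon> *\<^sub>R y j \<notin> hyperbolicity_cone g e"
    using uniform_chain_in_factor[of G e Y k] \<open>finite G\<close> G Y(1) out unfolding cone by blast
  obtain d where "d \<le> k" and form: "hyperbolic_form g e d"
    using G[OF \<open>g \<in> G\<close>] by blast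
  have "k + 1 \<le> d"
    by (rule hyperbolic_form.chain_bound[OF form, of "k + 1" y]) (use y in simp_all)
  with \<open>d \<le> k\<close> show False by simp
qed

end
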